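(* Let $A\in\mathbb{R}^{m\times n}$ ($m,n\ge 1$) have no zero rows, let $r=\mathrm{rank}(A)$, and let $b\in\mathrm{range}(A)$. Let $\hat A$, $L$, $P_m$ be the matrices associated with $A$ as defined in the context. Let $(x_k)_{k\ge0}$ be the full-cycle iterates of the cyclic Kaczmarz method for $Ax=b$ started at an arbitrary $x_0\in\mathbb{R}^n$, and let $x^*$ be the solution of $Ax=b$ closest to $x_0$. Then the squared residual $\|Ax_k-b\|^2=\|A(x_k-x^* )\|^2$ converges geometrically; specifically, for all $k\ge1$, $$\|Ax_k-b\|^2\le\min\Bigg\{\frac{\max_{i}\|a_i\|^2\,\|L-I_m\|_{\mathrm{op}}^2\,\|AP_m\|_{\mathrm{op}}^2}{\|AP_m\|_{\mathrm{op}}^2+\max_{i}\|a_i\|^2\,\|L-I_m\|_{\mathrm{op}}^2}\Bigg(\frac{\|L-I_m\|_{\mathrm{op}}^2}{\|L-I_m\|_{\mathrm{op}}^2+\sigma_r^2(\hat A)}\Bigg)^{k-1},\ \|AP_m\|_{\mathrm{op}}^2\Bigg(\frac{\|L-I_m\|_{\mathrm{op}}^2}{\|L-I_m\|_{\mathrm{op}}^2+\sigma_r^2(\hat A)}\Bigg)^{k}\Bigg\}\|x_0-x^*\|^2,$$ where the maxima are over $1\le i\le m$, and where $$\|AP_m\|_{\mathrm{op}}^2\le\min\Big\{\sum_{i=1}^m\|a_i\|^2\big(1-\langle\hat a_i,\hat a_m\rangle^2\big),\ \sigma_1^2(A)\Big\},$$ $$\|L-I_m\|_{\mathrm{op}}^2\le\min\Big\{\sum_{1\le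 i<j\le m}\langle\hat a_i,\hat a_j\rangle^2,\ \big(1+\lceil\log_2(r)\rceil/2\big)^2\sigma_1^4(\hat A)\Big\}.$$
   Context: $\|\cdot\|$ is the Euclidean norm on vectors and $\|\cdot\|_{\mathrm{op}}$ the induced operator (spectral) norm on matrices; $I_p$ is the $p\times p$ identity. The rows of $A$ are $a_1,\dots,a_m\in\mathbb{R}^n$ (viewed as column vectors), $\hat a_i=a_i/\|a_i\|$, and $\hat A\in\mathbb{R}^{m\times n}$ is the matrix with rows $\hat a_i$ (it also has rank $r$). For a matrix $B$ of rank $r$, $\sigma_1(B)\ge\dots\ge\sigma_r(B)>0$ denote its positive singular values. $L\in\mathbb{R}^{m\times m}$ is the unit lower triangular matrix with $L_{ij}=\langle\hat a_i,\hat a_j\rangle$ for $j<i$, $L_{ii}=1$, $L_{ij}=0$ for $j>i$. $P_m:=I_n-\hat a_m\hat a_m^\top\in\mathbb{R}^{n\times n}$. Conventions: an expression of the form $ab/(a+b)$ is taken to be $0$ when $a=b=0$; a zeroth power equals $1$. Cyclic Kaczmarz method: $x_{0,0}=x_0$; for each $k\ge0$ and $i=1,\dots,m$ in this order, $x_{k,i}=x_{k,i-1}-\frac{\langle a_i,x_{k,i-1}\rangle-b^{(i)}}{\|a_i\|^2}a_i$, where $b^{(i)}$ is the $i$-th entry of $b$; then $x_{k+1}=x_{k+1,0}=x_{k,m}$ (and $x_{k,0}=x_k$). $x^*=\mathrm{argmin}_{x:\,Ax=b}\|x_0-x\|=x_0-A^\dagger(Ax_0-b)$, where $A^\dagger$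 is the Moore–Penrose pseudoinverse. *)

theory Defs
  imports "HOL-Analysis.Analysis"
begin

text \<open>
  An \<open>m \<times> n\<close> matrix is an element of \<open>real^'n^'m\<close>, so that \<open>A $ i\<close> is its \<open>i\<close>-th row.
  Wherever the order of the rows matters, \<open>'m\<close> is in addition linearly ordered: its least
  element plays the role of row \<open>1\<close> and its greatest element, \<open>Max UNIV\<close>, that of row \<open>m\<close>.
\<close>

abbreviation op_norm :: "real^'n^'m \<Rightarrow> real" where
  "op_norm M \<equiv> onorm ((*v) M)"

definition normalize_rows :: "real^'n^'m \<Rightarrow> real^'n^'m" where
  "normalize_rows A = (\<chi> i. A $ i /\<^sub>R norm (A $ i))"

definition lower_gram ::
    "real^'n^'m::{finite,linorder} \<Rightarrow> real^'m::{finite,linorder}^'m::{finite,linorder}" where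
  "lower_gram A = (\<chi> i j. if j < i then normalize_rows A $ i \<bullet> normalize_rows A $ j
                          else if j = i then 1 else 0)"

definition last_row_proj :: "real^'n^'m::{finite,linorder} \<Rightarrow> real^'n^'n" where
  "last_row_proj A = (let u = normalize_rows A $ Max UNIV
     in mat 1 - (columnvector u :: real^1^'n) ** (rowvector u :: real^'n^1))"

definition kaczmarz_step :: "real^'n^'m \<Rightarrow> real^'m \<Rightarrow> 'm \<Rightarrow> real^'n \<Rightarrow> real^'n" where
  "kaczmarz_step A b i x = x - ((A $ i \<bullet> x - b $ i) / (norm (A $ i))\<^sup>2) *\<^sub>R A $ i"

text \<open>One full cycle visits the rows in increasing order.\<close>

definition kaczmarz_cycle ::
    "real^'n^'m::{finite,linorder} \<Rightarrow> real^'m::{finite,linorder} \<Rightarrow> real^'n \<Rightarrow> real^'n" where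
  "kaczmarz_cycle A b x = fold (kaczmarz_step A b) (sorted_list_of_set UNIV) x"

primrec kaczmarz ::
    "real^'n^'m::{finite,linorder} \<Rightarrow> real^'m::{finite,linorder} \<Rightarrow> real^'n \<Rightarrow> nat \<Rightarrow> real^'n" where
  "kaczmarz A b x\<^sub>0 0 = x\<^sub>0"
| "kaczmarz A b x\<^sub>0 (Suc k) = kaczmarz_cycle A b (kaczmarz A b x\<^sub>0 k)"

text \<open>
  The positive singular values of \<open>B\<close> are the square roots of the positive eigenvalues of
  \<open>transpose B ** B\<close>, counted with multiplicity, i.e. the dimension of the eigenspace.
\<close>

definition sv_space :: "real^'n^'m \<Rightarrow> real \<Rightarrow> (real^'n) set" where
  "sv_space B s = {v. (transpose B ** B) *v v = s\<^sup>2 *\<^sub>R v}"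

definition pos_singular_value_set :: "real^'n^'m \<Rightarrow> real set" where
  "pos_singular_value_set B = {s. 0 < s \<and> (\<exists>v\<in>sv_space B s. v \<noteq> 0)}"

lemma finite_pos_singular_value_set: "finite (pos_singular_value_set B)"
proof -
  let ?S = "pos_singular_value_set B"
  have "\<forall>s\<in>?S. \<exists>v. v \<in> sv_space B s \<and> v \<noteq> 0"
    by (auto simp: pos_singular_value_set_def)
  then obtain v where v: "\<And>s. s \<in> ?S \<Longrightarrow> v s \<in> sv_space B s \<and> v s \<noteq> 0"
    using bchoice[of ?S "\<lambda>s v. v \<in> sv_space B s \<and> v \<noteq> 0"] by blast
  have sym: "((transpose B ** B) *v x) \<bullet> y = x \<bullet> ((transpose B ** B) *v y)" for x y
    by (metis dot_lmul_matrix matrix_transpose_mul transpose_transpose vector_transpose_matrix)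
  have orth: "v s \<bullet> v t = 0" if "s \<in> ?S" "t \<in> ?S" "s \<noteq> t" for s t
  proof -
    have "s\<^sup>2 * (v s \<bullet> v t) = t\<^sup>2 * (v s \<bullet> v t)"
      using sym[of "v s" "v t"] v[OF that(1)] v[OF that(2)] by (simp add: sv_space_def)
    moreover have "s\<^sup>2 \<noteq> t\<^sup>2"
      using that by (auto simp: pos_singular_value_set_def power2_eq_iff)
    ultimately show ?thesis by simp
  qed
  have "inj_on v ?S"
    by (rule inj_onI) (metis orth v inner_eq_zero_iff)
  moreover have "finite (v ` ?S)"
  proof (rule independent_imp_finite, rule pairwise_orthogonal_independent)
    show "pairwise orthogonal (v ` ?S)"
      using orth by (fastforce simp: pairwise_def orthogonal_def)
    show "0 \<notin> v ` ?S" using v by force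
  qed
  ultimately show ?thesis using finite_imageD by blast
qed

definition pos_singular_values :: "real^'n^'m \<Rightarrow> real list" where
  "pos_singular_values B = concat (map (\<lambda>s. replicate (dim (sv_space B s)) s)
     (rev (sorted_list_of_set (pos_singular_value_set B))))"

text \<open>\<open>singular_value B k\<close> is \<open>\<sigma>\<^sub>k(B)\<close>, for \<open>1 \<le> k \<le> rank B\<close>.\<close>

definition singular_value :: "real^'n^'m \<Rightarrow> nat \<Rightarrow> real" where
  "singular_value B k = pos_singular_values B ! (k - 1)"

end

theory Submission
  imports Defs
begin

text \<open>
  Let \<open>e\<^sub>k = x\<^sub>k - x\<^sup>*\<close> and let \<open>y\<close> collect the normalized residuals met during one cycle, so that
  \<open>L y\<close> is the normalized residual before the cycle. Then \<open>\<parallel>e\<^sub>k\<^sub>+\<^sub>1\<parallel>\<^sup>2 = \<parallel>e\<^sub>k\<parallel>\<^sup>2 - \<parallel>y\<parallel>\<^sup>2\<close>, and the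
  normalized residual after the cycle is \<open>- (L - I)\<^sup>T y\<close>. Its square is therefore at most
  \<open>\<parallel>L - I\<parallel>\<^sup>2 (\<parallel>e\<^sub>k\<parallel>\<^sup>2 - \<parallel>e\<^sub>k\<^sub>+\<^sub>1\<parallel>\<^sup>2)\<close>, and at least \<open>\<sigma>\<^sub>r\<^sup>2 \<parallel>e\<^sub>k\<^sub>+\<^sub>1\<parallel>\<^sup>2\<close> because the errors are orthogonal
  to the kernel; this gives the rate. Combining the upper bound with \<open>e\<^sub>k\<^sub>+\<^sub>1 = P\<^sub>m e\<^sub>k\<^sub>+\<^sub>1\<close> gives the
  harmonic-mean prefactor.

  For the logarithmic bound on \<open>\<parallel>L - I\<parallel>\<close>, the index set is halved \<open>\<lceil>log\<^sub>2 r\<rceil>\<close> times. Each halving costs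
  one off-diagonal block of the Gram matrix, of norm at most \<open>\<sigma>\<^sub>1\<^sup>2 / 2\<close>. The remaining triangles have
  fewer than \<open>m / r + 1\<close> rows, and \<open>m / r \<le> \<sigma>\<^sub>1\<^sup>2\<close> by the trace, so the Frobenius norm of each,
  bounded by the number of its rows minus one, is at most \<open>\<sigma>\<^sub>1\<^sup>2\<close>.
\<close>

section \<open>Eigenbases of self-adjoint operators\<close>

lemma orthonormal_expansion:
  fixes E :: "'a::euclidean_space set"
  assumes fin: "finite E" and orth: "pairwise orthogonal E"
    and norm1: "\<And>e. e \<in> E \<Longrightarrow> norm e = 1" and span: "span E = UNIV"
  shows "x = (\<Sum>e\<in>E. (x \<bullet> e) *\<^sub>R e)"
proof -
  let ?y = "x - (\<Sum>e\<in>E. (x \<bullet> e) *\<^sub>R e)"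
  have ee: "e \<bullet> e' = (if e = e' then 1 else 0)" if "e \<in> E" "e' \<in> E" for e e'
    using that orth norm1 by (auto simp: pairwise_def orthogonal_def dot_square_norm)
  have "orthogonal ?y e" if "e \<in> E" for e
  proof -
    have "(\<Sum>e'\<in>E. (x \<bullet> e') *\<^sub>R e') \<bullet> e = (\<Sum>e'\<in>E. if e' = e then x \<bullet> e else 0)"
      unfolding inner_sum_left by (rule sum.cong) (auto simp: ee that)
    then show ?thesis
      using fin that by (simp add: orthogonal_def inner_diff_left)
  qed
  \<comment> \<open>The remainder is orthogonal to a spanning set, hence to itself.\<close>
  then have "orthogonal ?y ?y"
    using orthogonal_to_span[of ?y E ?y] span by (simp add: orthogonal_commute)
  then show ?thesis
    by (simp add: orthogonal_self)
qed

lemma orthonormal_parseval: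
  fixes E :: "'a::euclidean_space set"
  assumes "finite E" "pairwise orthogonal E" "\<And>e. e \<in> E \<Longrightarrow> norm e = 1" "span E = UNIV"
  shows "x \<bullet> y = (\<Sum>e\<in>E. (x \<bullet> e) * (y \<bullet> e))"
proof -
  have "x \<bullet> y = (\<Sum>e\<in>E. (x \<bullet> e) *\<^sub>R e) \<bullet> y"
    using orthonormal_expansion[OF assms, of x] by simp
  then show ?thesis
    by (simp add: inner_sum_left inner_commute[of y])
qed

text \<open>A maximizer \<open>v\<close> of \<open>x \<bullet> f x\<close> on the unit sphere of
  \<open>S\<close> is an eigenvector, because the first variation along its defect \<open>w\<close>
  must vanish. Working inside an invariant subspace allows the result to be applied to an orthogonal
  complement.\<close>

lemma self_adjoint_eigenvector:
  fixes f :: "'a::euclidean_space \<Rightarrow> 'a"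
  assumes lin: "linear f" and sym: "\<And>x y. f x \<bullet> y = x \<bullet> f y"
    and S: "subspace S" "f ` S \<subseteq> S" "S \<noteq> {0}"
  obtains v c where "v \<in> S" "norm v = 1" "f v = c *\<^sub>R v"
proof -
  define U where "U = S \<inter> sphere 0 1"
  interpret f: linear f by (rule lin)
  have "compact U"
    unfolding U_def using closed_subspace[OF S(1)] by (simp add: closed_Int_compact)
  moreover have "U \<noteq> {}"
  proof -
    obtain w where w: "w \<in> S" "w \<noteq> 0" using S(1,3) subspace_0 by blast
    then have "(1 / norm w) *\<^sub>R w \<in> U"
      using S(1) by (simp add: U_def subspace_scale)
    then show ?thesis by blast
  qed
  moreover have "continuous_on U (\<lambda>x. x \<bullet> f x)"
    by (intro continuous_intros linear_continuous_on linear_linear[THEN iffD2] lin)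
  ultimately obtain v where v: "v \<in> U" and max: "\<And>x. x \<in> U \<Longrightarrow> x \<bullet> f x \<le> v \<bullet> f v"
    using continuous_attains_sup[of U "\<lambda>x. x \<bullet> f x"] by blast
  define c where "c = v \<bullet> f v"
  define w where "w = f v - c *\<^sub>R v"
  have vS: "v \<in> S" and v1: "norm v = 1" using v by (auto simp: U_def)
  have wS: "w \<in> S"
    unfolding w_def using S vS by (meson image_subset_iff subspace_diff subspace_scale)
  have nonneg: "0 \<le> c * (x \<bullet> x) - x \<bullet> f x" if "x \<in> S" for x
  proof (cases "x = 0")
    case False
    have "(1 / norm x) *\<^sub>R x \<in> U"
      using S(1) that False by (simp add: U_def subspace_scale)
    from max[OF this] show ?thesis
      using False by (simp add: c_def f.scale field_simps dot_square_norm power2_eq_square)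
  qed simp
  define a where "a = c * (w \<bullet> w) - w \<bullet> f w"
  \<comment> \<open>Maximality at \<open>v + t *\<^sub>R w\<close>: the constant term of this
    quadratic in \<open>t\<close> vanishes by the choice of \<open>c\<close>, and its linear
    coefficient is \<open>- 2 * (w \<bullet> w)\<close>.\<close>
  have ineq: "2 * t * (w \<bullet> w) \<le> t\<^sup>2 * a" for t
  proof -
    have "v + t *\<^sub>R w \<in> S" using S(1) vS wS by (simp add: subspace_add subspace_scale)
    from nonneg[OF this]
    have "0 \<le> c * ((v + t *\<^sub>R w) \<bullet> (v + t *\<^sub>R w)) - (v + t *\<^sub>R w) \<bullet> (f v + t *\<^sub>R f w)"
      by (simp add: f.add f.scale)
    also have "\<dots> = c * (v \<bullet> v) - v \<bullet> f v + 2 * t * (c * (v \<bullet> w)) - t * (w \<bullet> f v) - t * (v \<bullet> f w) + t\<^sup>2 * a"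
      by (simp add: inner_add_left inner_add_right a_def algebra_simps inner_commute power2_eq_square)
    also have "c * (v \<bullet> v) - v \<bullet> f v = 0" by (simp add: c_def dot_square_norm v1)
    also have "v \<bullet> f w = w \<bullet> f v" by (metis sym inner_commute)
    also have "0 + 2 * t * (c * (v \<bullet> w)) - t * (w \<bullet> f v) - t * (w \<bullet> f v) = - 2 * t * (w \<bullet> w)"
    proof -
      have "w \<bullet> f v = w \<bullet> w + c * (v \<bullet> w)"
        by (subst (3) w_def) (simp add: inner_diff_right inner_commute)
      then show ?thesis by (simp only:) (simp add: algebra_simps)
    qed
    finally show ?thesis by simp
  qed
  have "w \<bullet> w \<le> 0"
  proof (rule ccontr)
    assume "\<not> w \<bullet> w \<le> 0"
    then have pos: "w \<bullet> w > 0" by linarith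
    \<comment> \<open>The value \<open>t = 1\<close> shows that \<open>a\<close> is positive; then
      \<open>t = w \<bullet> w / a\<close> makes the linear term exceed the quadratic one.\<close>
    have "2 * (w \<bullet> w) \<le> a" using ineq[of 1] by simp
    then have apos: "a > 0" using pos by linarith
    have "2 * (w \<bullet> w / a) * (w \<bullet> w) \<le> (w \<bullet> w / a)\<^sup>2 * a" by (rule ineq)
    then have "(w \<bullet> w) * (w \<bullet> w) \<le> 0"
      using apos by (simp add: power2_eq_square field_simps)
    then show False using pos by (simp add: mult_le_0_iff)
  qed
  then have "w = 0" by (metis inner_eq_zero_iff inner_ge_zero order_antisym)
  then have "f v = c *\<^sub>R v" by (simp add: w_def)
  then show thesis using that vS v1 by blast
qed

text \<open>An orthonormal set of eigenvectors of maximal size must span: by self-adjointness its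
  orthogonal complement is invariant, so a nonzero complement would contain one more
  eigenvector.\<close>

theorem self_adjoint_eigenbasis:
  fixes f :: "'a::euclidean_space \<Rightarrow> 'a"
  assumes lin: "linear f" and sym: "\<And>x y. f x \<bullet> y = x \<bullet> f y"
  obtains E where "finite E" "pairwise orthogonal E" "\<And>e. e \<in> E \<Longrightarrow> norm e = 1"
    "span E = UNIV" "\<And>e. e \<in> E \<Longrightarrow> \<exists>c. f e = c *\<^sub>R e"
proof -
  define Q where "Q E \<longleftrightarrow> finite E \<and> pairwise orthogonal E \<and> (\<forall>e\<in>E. norm e = 1 \<and> (\<exists>c. f e = c *\<^sub>R e))"
    for E
  have indep: "independent E" if "Q E" for E
    using that by (intro pairwise_orthogonal_independent) (auto simp: Q_def)
  have "card E < Suc (DIM('a))" if "Q E" for E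
    using independent_bound[OF indep[OF that]] by simp
  moreover have "Q {}" by (simp add: Q_def)
  ultimately obtain E where E: "Q E" and max: "\<And>F. Q F \<Longrightarrow> card F \<le> card E"
    using ex_has_greatest_nat[of Q "{}" card "Suc DIM('a)"] by (metis less_imp_le)
  define S where "S = {x. \<forall>e\<in>E. orthogonal e x}"
  have "subspace S"
    unfolding S_def by (auto simp: subspace_def orthogonal_def inner_add_right)
  moreover have "f ` S \<subseteq> S"
  proof -
    have "e \<bullet> f x = 0" if xe: "x \<in> S" "e \<in> E" for x e
    proof -
      obtain c where "f e = c *\<^sub>R e" using E xe(2) unfolding Q_def by blast
      then show ?thesis using xe sym[of e x] by (simp add: S_def orthogonal_def)
    qed
    then show ?thesis by (auto simp: S_def orthogonal_def)
  qed
  moreover have False if vS: "v \<in> S" and v1: "norm v = 1" and fv: "f v = c *\<^sub>R v" for v c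
  proof -
    have "v \<notin> E" using vS v1 by (auto simp: S_def orthogonal_def)
    moreover have "Q (insert v E)"
      using E vS v1 fv by (auto simp: Q_def S_def pairwise_insert orthogonal_commute)
    ultimately show False
      using max[of "insert v E"] E by (simp add: Q_def)
  qed
  ultimately have S0: "S = {0}"
    using self_adjoint_eigenvector[OF lin sym, of S] by blast
  have "x \<in> span E" for x
  proof -
    obtain y z where y: "y \<in> span E" and z: "\<And>w. w \<in> span E \<Longrightarrow> orthogonal z w" and x: "x = y + z"
      using orthogonal_subspace_decomp_exists[of E x] by blast
    have "z \<in> S" unfolding S_def by (simp add: orthogonal_commute[of _ z] z span_base)
    then show ?thesis using S0 x y by simp
  qed
  then show thesis using that[of E] E by (auto simp: Q_def)
qed

section \<open>Singular values\<close>

lemma norm_power2_vec: "(norm v)\<^sup>2 = (\<Sum>i\<in>UNIV. (v $ i)\<^sup>2)" for v :: "real^'n"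
  unfolding power2_norm_eq_inner by (simp add: inner_vec_def power2_eq_square)

lemma norm_matrix_vector: "(norm (B *v x))\<^sup>2 = (\<Sum>i\<in>UNIV. (B $ i \<bullet> x)\<^sup>2)"
  for B :: "real^'n^'m"
  by (simp add: norm_power2_vec matrix_vector_mul_component)

lemma dot_gram: "((transpose B ** B) *v x) \<bullet> y = (B *v x) \<bullet> (B *v y)"
  for B :: "real^'n^'m"
  by (simp add: dot_lmul_matrix flip: matrix_vector_mul_assoc)

text \<open>\<open>E\<close> is a complete set of right singular vectors, kernel directions
  included. Writing the eigenvalue as \<open>(norm (B *v e))\<^sup>2\<close> lets the singular value
  of \<open>e\<close> be read off as \<open>norm (B *v e)\<close>.\<close>

locale singular_basis =
  fixes B :: "real^'n^'m" and E :: "(real^'n) set"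
  assumes fin: "finite E" and orth: "pairwise orthogonal E"
    and norm1: "\<And>e. e \<in> E \<Longrightarrow> norm e = 1" and span: "span E = UNIV"
    and eigen: "\<And>e. e \<in> E \<Longrightarrow> (transpose B ** B) *v e = (norm (B *v e))\<^sup>2 *\<^sub>R e"

lemma singular_basis_exists:
  fixes B :: "real^'n^'m"
  obtains E where "singular_basis B E"
proof -
  have "((transpose B ** B) *v x) \<bullet> y = x \<bullet> ((transpose B ** B) *v y)" for x y
    by (metis dot_gram inner_commute)
  then obtain E where E: "finite E" "pairwise orthogonal E" "\<And>e. e \<in> E \<Longrightarrow> norm e = 1"
    "span E = UNIV" "\<And>e. e \<in> E \<Longrightarrow> \<exists>c. (transpose B ** B) *v e = c *\<^sub>R e"
    using self_adjoint_eigenbasis[of "(*v) (transpose B ** B)"] by auto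
  have "(transpose B ** B) *v e = (norm (B *v e))\<^sup>2 *\<^sub>R e" if "e \<in> E" for e
  proof -
    obtain c where c: "(transpose B ** B) *v e = c *\<^sub>R e" using E(5)[OF \<open>e \<in> E\<close>] by blast
    have "c = ((transpose B ** B) *v e) \<bullet> e"
      using E(3)[OF that] by (simp add: c dot_square_norm)
    also have "\<dots> = (norm (B *v e))\<^sup>2"
      by (simp only: dot_gram dot_square_norm)
    finally show ?thesis using c by simp
  qed
  with E(1-4) have "singular_basis B E" by unfold_locales
  then show thesis by (rule that)
qed

context singular_basis
begin

lemmas expansion = orthonormal_expansion[OF fin orth norm1 span]
lemmas parseval = orthonormal_parseval[OF fin orth norm1 span]

lemma norm_parseval: "(norm x)\<^sup>2 = (\<Sum>e\<in>E. (x \<bullet> e)\<^sup>2)"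
  using parseval[of x x] by (simp add: dot_square_norm power2_eq_square)

lemma independent_subset:
  assumes "F \<subseteq> E" shows "independent F"
  using assms norm1 by (intro pairwise_orthogonal_independent pairwise_subset[OF orth]) force+

lemma image_inner: "(B *v x) \<bullet> (B *v e) = (norm (B *v e))\<^sup>2 * (x \<bullet> e)" if "e \<in> E"
  by (metis dot_gram eigen[OF that] inner_commute inner_scaleR_left)

lemma norm_image: "(norm (B *v x))\<^sup>2 = (\<Sum>e\<in>E. (norm (B *v e))\<^sup>2 * (x \<bullet> e)\<^sup>2)"
proof -
  have "(norm (B *v x))\<^sup>2 = ((transpose B ** B) *v x) \<bullet> x"
    by (simp add: dot_gram dot_square_norm)
  also have "\<dots> = (\<Sum>e\<in>E. (((transpose B ** B) *v x) \<bullet> e) * (x \<bullet> e))"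
    by (rule parseval)
  also have "\<dots> = (\<Sum>e\<in>E. (norm (B *v e))\<^sup>2 * (x \<bullet> e)\<^sup>2)"
    by (rule sum.cong) (simp_all add: dot_gram image_inner power2_eq_square)
  finally show ?thesis .
qed

text \<open>Evaluating the Gram form of \<open>v\<close> against a basis vector in two ways kills
  the coefficient of \<open>v\<close> there, unless that basis vector belongs to the value
  \<open>s\<close>.\<close>

lemma sv_space_eq_span:
  assumes "0 < s" shows "sv_space B s = span {e\<in>E. norm (B *v e) = s}"
proof
  show "sv_space B s \<subseteq> span {e\<in>E. norm (B *v e) = s}"
  proof
    fix v assume v: "v \<in> sv_space B s"
    have "v \<bullet> e = 0" if "e \<in> E" "norm (B *v e) \<noteq> s" for e
    proof -
      have "s\<^sup>2 * (v \<bullet> e) = ((transpose B ** B) *v v) \<bullet> e"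
        using v by (simp add: sv_space_def)
      also have "\<dots> = (norm (B *v e))\<^sup>2 * (v \<bullet> e)"
        by (simp only: dot_gram image_inner[OF that(1)])
      finally have "s\<^sup>2 * (v \<bullet> e) = (norm (B *v e))\<^sup>2 * (v \<bullet> e)" .
      moreover have "s\<^sup>2 \<noteq> (norm (B *v e))\<^sup>2"
        using that assms by (simp add: power2_eq_iff_nonneg)
      ultimately show ?thesis by simp
    qed
    then have "(v \<bullet> e) *\<^sub>R e \<in> span {e\<in>E. norm (B *v e) = s}" if "e \<in> E" for e
      using that by (cases "norm (B *v e) = s") (auto intro!: span_scale intro: span_base span_zero)
    then show "v \<in> span {e\<in>E. norm (B *v e) = s}"
      by (subst expansion[of v]) (auto intro: span_sum)
  qed
  have "subspace (sv_space B s)"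
    by (auto simp: sv_space_def subspace_def matrix_vector_right_distrib scaleR_add_right
        matrix_vector_mult_scaleR)
  then show "span {e\<in>E. norm (B *v e) = s} \<subseteq> sv_space B s"
    by (intro span_minimal) (auto simp: sv_space_def eigen)
qed

lemma dim_sv_space: "0 < s \<Longrightarrow> dim (sv_space B s) = card {e\<in>E. norm (B *v e) = s}"
  by (simp add: sv_space_eq_span dim_span_eq_card_independent[OF independent_subset] del: dim_span)

lemma pos_singular_value_set_eq:
  "pos_singular_value_set B = (\<lambda>e. norm (B *v e)) ` {e\<in>E. B *v e \<noteq> 0}"
proof -
  have "(\<exists>v\<in>sv_space B s. v \<noteq> 0) \<longleftrightarrow> (\<exists>e\<in>E. norm (B *v e) = s)" if "0 < s" for s
  proof
    assume "\<exists>v\<in>sv_space B s. v \<noteq> 0"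
    then have "{e\<in>E. norm (B *v e) = s} \<noteq> {}"
      unfolding sv_space_eq_span[OF that] by (metis empty_iff insertE span_empty)
    then show "\<exists>e\<in>E. norm (B *v e) = s" by blast
  next
    assume "\<exists>e\<in>E. norm (B *v e) = s"
    then obtain e where e: "e \<in> E" "norm (B *v e) = s" by blast
    then have "e \<in> sv_space B s" by (simp add: sv_space_def eigen)
    moreover have "e \<noteq> 0" using norm1[OF e(1)] by force
    ultimately show "\<exists>v\<in>sv_space B s. v \<noteq> 0" by blast
  qed
  then have "pos_singular_value_set B = {s. 0 < s \<and> (\<exists>e\<in>E. norm (B *v e) = s)}"
    by (simp add: pos_singular_value_set_def cong: conj_cong)
  also have "\<dots> = (\<lambda>e. norm (B *v e)) ` {e\<in>E. B *v e \<noteq> 0}"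
    by force
  finally show ?thesis .
qed

text \<open>\<open>B\<close> maps distinct basis vectors to orthogonal images, so the nonzero images
  form a basis of the range.\<close>

lemma rank_eq_card: "rank B = card {e\<in>E. B *v e \<noteq> 0}"
proof -
  let ?F = "{e\<in>E. B *v e \<noteq> 0}"
  have orth': "(B *v e) \<bullet> (B *v e') = 0" if "e \<in> E" "e' \<in> E" "e \<noteq> e'" for e e'
    using that orth by (simp add: image_inner pairwise_def orthogonal_def)
  have inj: "inj_on ((*v) B) ?F"
    by (rule inj_onI) (metis (mono_tags, lifting) inner_eq_zero_iff mem_Collect_eq orth')
  have indep: "independent ((*v) B ` ?F)"
    using orth' by (intro pairwise_orthogonal_independent) (auto simp: pairwise_def orthogonal_def)
  have "span ((*v) B ` ?F) = span (range ((*v) B))"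
  proof
    show "span ((*v) B ` ?F) \<subseteq> span (range ((*v) B))" by (intro span_mono) auto
    have "B *v x \<in> span ((*v) B ` ?F)" for x
    proof -
      have "B *v x = (\<Sum>e\<in>E. (x \<bullet> e) *\<^sub>R (B *v e))"
        using linear_sum[OF bounded_linear.linear[OF matrix_vector_mul_bounded_linear], of B "\<lambda>e. (x \<bullet> e) *\<^sub>R e" E]
        by (simp add: matrix_vector_mult_scaleR flip: expansion)
      also have "\<dots> \<in> span ((*v) B ` ?F)"
      proof (rule span_sum)
        fix e assume "e \<in> E"
        then show "(x \<bullet> e) *\<^sub>R (B *v e) \<in> span ((*v) B ` ?F)"
          by (cases "B *v e = 0") (auto intro!: span_scale intro: span_base span_zero)
      qed
      finally show ?thesis .
    qed
    then show "span (range ((*v) B)) \<subseteq> span ((*v) B ` ?F)"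
      by (intro span_minimal) auto
  qed
  from dim_eq_card[OF this indep] have "dim (range ((*v) B)) = card ((*v) B ` ?F)" .
  then show ?thesis using inj by (simp add: rank_dim_range card_image)
qed

text \<open>Each basis vector outside the kernel is counted exactly once, at the value
  \<open>norm (B *v e)\<close>. It follows that \<open>singular_value B k\<close> reads an existing
  list entry for every \<open>k\<close> from 1 to the rank.\<close>

lemma length_pos_singular_values: "length (pos_singular_values B) = rank B"
proof -
  let ?S = "pos_singular_value_set B" and ?F = "{e\<in>E. B *v e \<noteq> 0}"
  have "length (pos_singular_values B) = sum_list (map (\<lambda>s. dim (sv_space B s)) (sorted_list_of_set ?S))"
    by (simp add: pos_singular_values_def length_concat o_def rev_map[symmetric] sum_list_rev)
  also have "\<dots> = (\<Sum>s\<in>?S. dim (sv_space B s))"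
    using finite_pos_singular_value_set[of B]
    by (simp add: sum_list_distinct_conv_sum_set)
  also have "\<dots> = (\<Sum>s\<in>?S. card {e\<in>?F. norm (B *v e) = s})"
  proof (rule sum.cong)
    fix s assume "s \<in> ?S"
    then have s: "0 < s" by (simp add: pos_singular_value_set_def)
    then have "{e\<in>E. norm (B *v e) = s} = {e\<in>?F. norm (B *v e) = s}" by auto
    then show "dim (sv_space B s) = card {e\<in>?F. norm (B *v e) = s}"
      using dim_sv_space[OF s] by simp
  qed simp
  also have "\<dots> = card ?F"
    using sum_fun_comp[of ?F ?S "\<lambda>e. norm (B *v e)" "\<lambda>_. 1::nat"] fin
      finite_pos_singular_value_set[of B] by (simp add: pos_singular_value_set_eq)
  finally show ?thesis by (simp add: rank_eq_card)
qed


end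

lemma set_pos_singular_values: "set (pos_singular_values B) = pos_singular_value_set B"
  for B :: "real^'n^'m"
proof -
  obtain E where "singular_basis B E" by (rule singular_basis_exists)
  then interpret singular_basis B E .
  \<comment> \<open>Otherwise \<open>replicate\<close> would drop the value \<open>s\<close> from
    the list.\<close>
  have "dim (sv_space B s) \<noteq> 0" if "s \<in> pos_singular_value_set B" for s
    using that by (auto simp: pos_singular_value_set_def dim_eq_0)
  then show ?thesis
    using finite_pos_singular_value_set[of B] by (auto simp: pos_singular_values_def)
qed

lemma sorted_pos_singular_values: "sorted_wrt (\<ge>) (pos_singular_values B)"
proof -
  have "sorted_wrt (\<ge>) (replicate n a)" for n and a :: real
    by (induction n) auto
  then have "sorted_wrt (\<ge>) (concat (map (\<lambda>s. replicate (d s) s) xs))"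
    if "sorted_wrt (\<ge>) xs" for d :: "real \<Rightarrow> nat" and xs
    using that by (induction xs) (auto simp: sorted_wrt_append)
  then show ?thesis
    unfolding pos_singular_values_def by (simp add: sorted_wrt_rev)
qed

lemma singular_value_bounds:
  fixes B :: "real^'n^'m"
  assumes "s \<in> pos_singular_value_set B"
  shows "singular_value B (rank B) \<le> s" "s \<le> singular_value B 1"
proof -
  obtain E where "singular_basis B E" by (rule singular_basis_exists)
  then interpret singular_basis B E .
  have "s \<in> set (pos_singular_values B)" using assms by (simp add: set_pos_singular_values)
  then obtain i where i: "i < rank B" "s = pos_singular_values B ! i"
    by (metis in_set_conv_nth length_pos_singular_values)
  have *: "pos_singular_values B ! j \<le> pos_singular_values B ! k" if "k \<le> j" "j < rank B" for j k
    using sorted_pos_singular_values[of B] that length_pos_singular_values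
    by (cases "k = j") (auto simp: sorted_wrt_iff_nth_less)
  show "singular_value B (rank B) \<le> s" "s \<le> singular_value B 1"
    using i *[of i "rank B - 1"] *[of 0 i] by (auto simp: singular_value_def)
qed

lemma singular_value_pos:
  fixes B :: "real^'n^'m"
  assumes "1 \<le> k" "k \<le> rank B"
  shows "0 < singular_value B k"
proof -
  obtain E where "singular_basis B E" by (rule singular_basis_exists)
  then interpret singular_basis B E .
  have "singular_value B k \<in> set (pos_singular_values B)"
    using assms by (simp add: singular_value_def length_pos_singular_values)
  then show ?thesis by (simp add: set_pos_singular_values pos_singular_value_set_def)
qed

text \<open>In singular coordinates each component is stretched by at most the largest singular
  value. The condition \<open>B \<noteq> 0\<close> makes the rank positive; for the zero matrix
  \<open>singular_value B 1\<close> would read an empty list.\<close>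

lemma norm_le_singular_value:
  fixes B :: "real^'n^'m"
  assumes "B \<noteq> 0"
  shows "norm (B *v x) \<le> singular_value B 1 * norm x"
proof -
  obtain E where "singular_basis B E" by (rule singular_basis_exists)
  then interpret singular_basis B E .
  have pos: "0 < singular_value B 1"
    using assms by (intro singular_value_pos) (auto simp: Suc_le_eq neq0_conv[symmetric] rank_eq_0)
  have "(norm (B *v x))\<^sup>2 \<le> (\<Sum>e\<in>E. (singular_value B 1)\<^sup>2 * (x \<bullet> e)\<^sup>2)"
  proof (subst norm_image, intro sum_mono mult_right_mono)
    fix e assume "e \<in> E"
    then show "(norm (B *v e))\<^sup>2 \<le> (singular_value B 1)\<^sup>2"
      using singular_value_bounds(2)[of "norm (B *v e)" B] pos
      by (cases "B *v e = 0") (auto simp: pos_singular_value_set_eq intro: power_mono)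
  qed simp
  also have "\<dots> = (singular_value B 1 * norm x)\<^sup>2"
    by (simp add: power_mult_distrib norm_parseval flip: sum_distrib_left)
  finally show ?thesis
    using pos by (simp add: power2_le_iff_abs_le)
qed

text \<open>Orthogonality to the kernel removes the components that \<open>B\<close> annihilates;
  every other component is stretched by at least the smallest positive singular value.\<close>

lemma singular_value_le_norm:
  fixes B :: "real^'n^'m"
  assumes "\<And>w. B *v w = 0 \<Longrightarrow> x \<bullet> w = 0" and "B \<noteq> 0"
  shows "(singular_value B (rank B))\<^sup>2 * (norm x)\<^sup>2 \<le> (norm (B *v x))\<^sup>2"
proof -
  obtain E where "singular_basis B E" by (rule singular_basis_exists)
  then interpret singular_basis B E .
  have pos: "0 < singular_value B (rank B)"
    using assms(2) by (intro singular_value_pos) (auto simp: Suc_le_eq neq0_conv[symmetric] rank_eq_0)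
  have "(singular_value B (rank B))\<^sup>2 * (norm x)\<^sup>2 = (\<Sum>e\<in>E. (singular_value B (rank B))\<^sup>2 * (x \<bullet> e)\<^sup>2)"
    by (simp add: norm_parseval sum_distrib_left)
  also have "\<dots> \<le> (norm (B *v x))\<^sup>2"
  proof (subst norm_image, intro sum_mono)
    fix e assume e: "e \<in> E"
    show "(singular_value B (rank B))\<^sup>2 * (x \<bullet> e)\<^sup>2 \<le> (norm (B *v e))\<^sup>2 * (x \<bullet> e)\<^sup>2"
    proof (cases "B *v e = 0")
      case True
      then show ?thesis using assms(1) by simp
    next
      case False
      then show ?thesis
        using singular_value_bounds(1)[of "norm (B *v e)" B] pos e
        by (auto simp: pos_singular_value_set_eq intro!: mult_right_mono power_mono)
    qed
  qed
  finally show ?thesis .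
qed

text \<open>Parseval on each row and an exchange of sums turn the squared Frobenius norm into the
  sum of squared singular values, of which only \<open>rank B\<close> many are nonzero. For unit
  rows the left side is the number of rows.\<close>

lemma frobenius_le_rank:
  fixes B :: "real^'n^'m"
  shows "(\<Sum>i\<in>UNIV. (norm (B $ i))\<^sup>2) \<le> real (rank B) * (singular_value B 1)\<^sup>2"
proof -
  obtain E where "singular_basis B E" by (rule singular_basis_exists)
  then interpret singular_basis B E .
  have "(\<Sum>i\<in>UNIV. (norm (B $ i))\<^sup>2) = (\<Sum>i\<in>UNIV. \<Sum>e\<in>E. (B $ i \<bullet> e)\<^sup>2)"
    by (simp only: norm_parseval)
  also have "\<dots> = (\<Sum>e\<in>E. \<Sum>i\<in>UNIV. (B $ i \<bullet> e)\<^sup>2)"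
    by (rule sum.swap)
  also have "\<dots> = (\<Sum>e\<in>E. (norm (B *v e))\<^sup>2)"
    by (simp only: norm_matrix_vector)
  also have "\<dots> = (\<Sum>e\<in>{e\<in>E. B *v e \<noteq> 0}. (norm (B *v e))\<^sup>2)"
    using fin by (intro sum.mono_neutral_right) auto
  also have "\<dots> \<le> (\<Sum>e\<in>{e\<in>E. B *v e \<noteq> 0}. (singular_value B 1)\<^sup>2)"
    using singular_value_bounds(2)[of _ B]
    by (intro sum_mono power_mono) (auto simp: pos_singular_value_set_eq)
  finally show ?thesis by (simp add: rank_eq_card)
qed

section \<open>Operator norms\<close>

lemma norm_le_op_norm: "norm (M *v x) \<le> op_norm M * norm x" for M :: "real^'n^'m"
  by (rule onorm) simp

lemma op_norm_leI: "(\<And>x. norm (M *v x) \<le> c * norm x) \<Longrightarrow> op_norm M \<le> c" for M :: "real^'n^'m"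
  by (rule onorm_le)

lemma op_norm_nonneg: "0 \<le> op_norm M" for M :: "real^'n^'m"
  by (rule onorm_pos_le) simp

text \<open>Pair \<open>y\<close> with the image under \<open>M\<close> of
  \<open>transpose M *v y\<close> and apply Cauchy-Schwarz. The constant is left free so that both
  \<open>op_norm\<close> and the largest singular value can take its place.\<close>

lemma norm_transpose_le:
  fixes M :: "real^'n^'m"
  assumes "\<And>x. norm (M *v x) \<le> c * norm x"
  shows "norm (transpose M *v y) \<le> c * norm y"
proof (cases "transpose M *v y = 0")
  case True
  \<comment> \<open>The hypothesis at a unit vector forces \<open>c\<close> to be
    nonnegative.\<close>
  have "0 \<le> c * norm (axis undefined 1 :: real^'n)"
    using assms norm_ge_zero order_trans by blast
  then show ?thesis using True by (simp add: norm_axis_1)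
next
  case False
  define z where "z = transpose M *v y"
  have "(transpose M *v y) \<bullet> z = y \<bullet> (M *v z)"
    by (simp add: dot_lmul_matrix)
  then have "norm z * norm z = y \<bullet> (M *v z)"
    by (simp only: z_def[symmetric] power2_norm_eq_inner[symmetric] power2_eq_square)
  also have "\<dots> \<le> norm y * (c * norm z)"
    using norm_cauchy_schwarz[of y "M *v z"] assms[of z]
    by (meson mult_left_mono norm_ge_zero order_trans)
  finally have "norm z * norm z \<le> norm z * (c * norm y)" by (simp add: mult_ac)
  then show ?thesis using False by (simp add: z_def)
qed

lemma op_norm_le_frobenius: "(op_norm M)\<^sup>2 \<le> (\<Sum>i\<in>UNIV. (norm (M $ i))\<^sup>2)" for M :: "real^'n^'m"
proof -
  let ?F = "\<Sum>i\<in>UNIV. (norm (M $ i))\<^sup>2"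
  have F: "0 \<le> ?F" by (simp add: sum_nonneg)
  have "norm (M *v x) \<le> sqrt ?F * norm x" for x
  proof -
    have "(norm (M *v x))\<^sup>2 \<le> (\<Sum>i\<in>UNIV. (norm (M $ i))\<^sup>2 * (norm x)\<^sup>2)"
      unfolding norm_matrix_vector
    proof (rule sum_mono)
      fix i
      show "(M $ i \<bullet> x)\<^sup>2 \<le> (norm (M $ i))\<^sup>2 * (norm x)\<^sup>2"
        using Cauchy_Schwarz_ineq[of "M $ i" x] by (simp add: power2_norm_eq_inner)
    qed
    also have "\<dots> = (sqrt ?F * norm x)\<^sup>2"
      using F by (simp add: power_mult_distrib flip: sum_distrib_right)
    finally show ?thesis using F by (simp add: power2_le_iff_abs_le)
  qed
  then have "op_norm M \<le> sqrt ?F" by (rule op_norm_leI)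
  then have "(op_norm M)\<^sup>2 \<le> (sqrt ?F)\<^sup>2" by (intro power_mono op_norm_nonneg)
  then show ?thesis using F by simp
qed

section \<open>Triangular truncation of Gram matrices\<close>

text \<open>For a Gram matrix \<open>g\<close> of unit vectors and \<open>S = UNIV\<close> this is
  the bilinear form of \<open>L - I\<close>. Restricting to index subsets, instead of forming
  submatrices, keeps the order of the rows during the halving.\<close>

definition strict_lower_form ::
    "('i::linorder \<Rightarrow> 'i \<Rightarrow> real) \<Rightarrow> 'i set \<Rightarrow> ('i \<Rightarrow> real) \<Rightarrow> ('i \<Rightarrow> real) \<Rightarrow> real" where
  "strict_lower_form g S x y = (\<Sum>i\<in>S. \<Sum>j\<in>{j\<in>S. j < i}. x i * g i j * y j)"

lemma exists_initial_segment:
  fixes S :: "'i::linorder set"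
  assumes "finite S" "k \<le> card S"
  shows "\<exists>T\<subseteq>S. card T = k \<and> (\<forall>t\<in>T. \<forall>u\<in>S - T. t < u)"
  using assms(2)
proof (induction k)
  case (Suc k)
  then obtain T where T: "T \<subseteq> S" "card T = k" "\<forall>t\<in>T. \<forall>u\<in>S - T. t < u" by auto
  define m where "m = Min (S - T)"
  have fin: "finite (S - T)" "finite T" using assms(1) T(1) finite_subset by auto
  have "S - T \<noteq> {}" using T Suc.prems by auto
  then have m: "m \<in> S - T" "\<And>u. u \<in> S - T \<Longrightarrow> m \<le> u"
    using Min_in[OF fin(1)] Min_le[OF fin(1)] unfolding m_def by blast+
  have "insert m T \<subseteq> S" "card (insert m T) = Suc k" using T m fin by auto
  moreover have "\<forall>t\<in>insert m T. \<forall>u\<in>S - insert m T. t < u"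
    using T(3) m by (force simp: less_le)
  ultimately show ?case by blast
qed auto

lemma L2_set_power2: "(L2_set f A)\<^sup>2 = (\<Sum>i\<in>A. (f i)\<^sup>2)"
  by (simp add: L2_set_def sum_nonneg)

text \<open>Cauchy-Schwarz over the pairs below the diagonal, that is, the Frobenius bound. The base
  case of the halving needs the constant to be \<open>p\<close>, one less than the allowed number of
  rows.\<close>

lemma strict_lower_form_le:
  fixes S :: "'i::linorder set"
  assumes fin: "finite S" and card: "card S \<le> Suc p"
    and g: "\<And>i j. \<bar>g i j\<bar> \<le> 1"
  shows "\<bar>strict_lower_form g S x y\<bar> \<le> real p * L2_set x S * L2_set y S"
proof (cases "S = {}")
  case False
  define P where "P = (SIGMA i:S. {j\<in>S. j < i})"
  have finP: "finite P" using fin by (simp add: P_def)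
  \<comment> \<open>The least index never occurs as a row and the greatest never as a column, which
    leaves at most \<open>p * p\<close> pairs.\<close>
  have "P \<subseteq> (S - {Min S}) \<times> (S - {Max S})"
    using fin by (auto simp: P_def Min_gr_iff not_less[symmetric] dest: Min_le Max_ge)
  then have "card P \<le> card ((S - {Min S}) \<times> (S - {Max S}))"
    using fin by (intro card_mono) auto
  also have "\<dots> \<le> p * p"
    using fin card False by (simp add: card_cartesian_product mult_le_mono)
  finally have "real (card P) \<le> (real p)\<^sup>2"
    by (metis of_nat_le_iff of_nat_mult power2_eq_square)
  moreover have "(\<Sum>(i, j)\<in>P. (g i j)\<^sup>2) \<le> real (card P)"
  proof -
    have "(g i j)\<^sup>2 \<le> 1" for i j using g[of i j] by (simp add: abs_square_le_1)
    then have "(\<Sum>(i, j)\<in>P. (g i j)\<^sup>2) \<le> (\<Sum>_\<in>P. 1)" by (intro sum_mono) auto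
    then show ?thesis by simp
  qed
  ultimately have G: "(\<Sum>(i, j)\<in>P. (g i j)\<^sup>2) \<le> (real p)\<^sup>2" by linarith
  have "(\<Sum>(i, j)\<in>P. (x i * y j)\<^sup>2) \<le> (\<Sum>(i, j)\<in>S \<times> S. (x i * y j)\<^sup>2)"
    using fin by (intro sum_mono2) (auto simp: P_def)
  also have "\<dots> = (L2_set x S)\<^sup>2 * (L2_set y S)\<^sup>2"
    by (simp add: L2_set_power2 sum_product power_mult_distrib flip: sum.cartesian_product)
  finally have XY: "(\<Sum>(i, j)\<in>P. (x i * y j)\<^sup>2) \<le> (L2_set x S)\<^sup>2 * (L2_set y S)\<^sup>2" .
  have "strict_lower_form g S x y = (\<Sum>(i, j)\<in>P. g i j * (x i * y j))"
    using fin by (simp add: strict_lower_form_def P_def sum.Sigma mult_ac)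
  then have "(strict_lower_form g S x y)\<^sup>2 \<le> (\<Sum>(i, j)\<in>P. (g i j)\<^sup>2) * (\<Sum>(i, j)\<in>P. (x i * y j)\<^sup>2)"
    using Cauchy_Schwarz_ineq_sum[of "\<lambda>(i, j). g i j" "\<lambda>(i, j). x i * y j" P]
    by (simp add: case_prod_beta)
  also have "\<dots> \<le> (real p)\<^sup>2 * ((L2_set x S)\<^sup>2 * (L2_set y S)\<^sup>2)"
    using G XY by (intro mult_mono) (auto intro!: sum_nonneg)
  also have "\<dots> = (real p * L2_set x S * L2_set y S)\<^sup>2"
    by (simp add: power_mult_distrib)
  finally have "\<bar>strict_lower_form g S x y\<bar> \<le> \<bar>real p * L2_set x S * L2_set y S\<bar>"
    by (simp only: abs_le_square_iff)
  then show ?thesis by (simp add: abs_mult)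
qed (simp add: strict_lower_form_def)

text \<open>All of \<open>T\<close> comes after \<open>S\<close>, so the block with rows in
  \<open>T\<close> and columns in \<open>S\<close> lies entirely below the diagonal and the opposite
  block entirely above. The Gram structure collapses the full block into one inner product.\<close>

lemma strict_lower_form_Un:
  fixes a :: "'i::linorder \<Rightarrow> 'v::real_inner"
  assumes "finite S" "finite T" and less: "\<And>s t. s \<in> S \<Longrightarrow> t \<in> T \<Longrightarrow> s < t"
  defines "g \<equiv> \<lambda>i j. a i \<bullet> a j"
  shows "strict_lower_form g (S \<union> T) x y = strict_lower_form g S x y + strict_lower_form g T x y
    + (\<Sum>i\<in>T. x i *\<^sub>R a i) \<bullet> (\<Sum>j\<in>S. y j *\<^sub>R a j)"
proof -
  have disj: "S \<inter> T = {}" using less by force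
  have S: "{j \<in> S \<union> T. j < i} = {j\<in>S. j < i}" if "i \<in> S" for i
    using less[OF that] by force
  have T: "{j \<in> S \<union> T. j < i} = {j\<in>T. j < i} \<union> S" if "i \<in> T" for i
    using less[OF _ that] by force
  have "strict_lower_form g (S \<union> T) x y
    = (\<Sum>i\<in>S. \<Sum>j\<in>{j\<in>S. j < i}. x i * g i j * y j) + (\<Sum>i\<in>T. \<Sum>j\<in>{j\<in>T. j < i} \<union> S. x i * g i j * y j)"
    unfolding strict_lower_form_def sum.union_disjoint[OF assms(1,2) disj]
    by (intro arg_cong2[of _ _ _ _ "(+)"] sum.cong) (simp_all only: S T)
  also have "(\<Sum>i\<in>T. \<Sum>j\<in>{j\<in>T. j < i} \<union> S. x i * g i j * y j)
    = (\<Sum>i\<in>T. (\<Sum>j\<in>{j\<in>T. j < i}. x i * g i j * y j) + (\<Sum>j\<in>S. x i * g i j * y j))"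
    using assms(1,2) disj by (intro sum.cong refl sum.union_disjoint) auto
  also have "\<dots> = strict_lower_form g T x y + (\<Sum>i\<in>T. x i *\<^sub>R a i) \<bullet> (\<Sum>j\<in>S. y j *\<^sub>R a j)"
    by (simp add: strict_lower_form_def sum.distrib inner_sum_left inner_sum_right g_def
        sum_distrib_left mult_ac sum.swap[of _ T S])
  finally show ?thesis by (simp add: strict_lower_form_def)
qed

text \<open>The factor one half comes from polarization: flipping the sign of one block preserves the
  upper bound, and the Gram form is bounded below by zero.\<close>

lemma abs_inner_block_le:
  fixes a :: "'i \<Rightarrow> 'v::real_inner"
  assumes K: "\<And>z. (norm (\<Sum>i\<in>S \<union> T. z i *\<^sub>R a i))\<^sup>2 \<le> K * (L2_set z (S \<union> T))\<^sup>2"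
    and fin: "finite S" "finite T" and disj: "S \<inter> T = {}"
  shows "\<bar>(\<Sum>i\<in>S. x i *\<^sub>R a i) \<bullet> (\<Sum>j\<in>T. y j *\<^sub>R a j)\<bar> \<le> K / 2 * L2_set x S * L2_set y T"
proof -
  define u v where "u = (\<Sum>i\<in>S. x i *\<^sub>R a i)" and "v = (\<Sum>j\<in>T. y j *\<^sub>R a j)"
  define X Y where "X = L2_set x S" and "Y = L2_set y T"
  have bound: "(norm (\<alpha> *\<^sub>R u + \<beta> *\<^sub>R v))\<^sup>2 \<le> K * (\<alpha>\<^sup>2 * X\<^sup>2 + \<beta>\<^sup>2 * Y\<^sup>2)" for \<alpha> \<beta>
  proof -
    let ?z = "\<lambda>i. if i \<in> S then \<alpha> * x i else \<beta> * y i"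
    have T: "i \<in> T \<Longrightarrow> i \<notin> S" for i using disj by blast
    have "(\<Sum>i\<in>S \<union> T. ?z i *\<^sub>R a i) = \<alpha> *\<^sub>R u + \<beta> *\<^sub>R v"
      using fin disj by (simp add: sum.union_disjoint u_def v_def scaleR_sum_right T cong: sum.cong)
    moreover have "(L2_set ?z (S \<union> T))\<^sup>2 = \<alpha>\<^sup>2 * X\<^sup>2 + \<beta>\<^sup>2 * Y\<^sup>2"
      using fin disj unfolding L2_set_power2 X_def Y_def
      by (simp add: sum.union_disjoint sum_distrib_left power_mult_distrib T cong: sum.cong)
    ultimately show ?thesis using K[of ?z] by simp
  qed
  have polar: "4 * (\<alpha> * \<beta> * (u \<bullet> v)) \<le> K * (\<alpha>\<^sup>2 * X\<^sup>2 + \<beta>\<^sup>2 * Y\<^sup>2)" for \<alpha> \<beta>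
  proof -
    have "4 * (\<alpha> * \<beta> * (u \<bullet> v)) = (norm (\<alpha> *\<^sub>R u + \<beta> *\<^sub>R v))\<^sup>2 - (norm (\<alpha> *\<^sub>R u - \<beta> *\<^sub>R v))\<^sup>2"
      by (simp add: power2_norm_eq_inner inner_add_left inner_add_right inner_diff_left
          inner_diff_right inner_commute algebra_simps)
    also have "\<dots> \<le> (norm (\<alpha> *\<^sub>R u + \<beta> *\<^sub>R v))\<^sup>2" by simp
    finally show ?thesis using bound[of \<alpha> \<beta>] by linarith
  qed
  have nonneg: "0 \<le> X" "0 \<le> Y" by (simp_all add: X_def Y_def L2_set_nonneg)
  have "\<bar>u \<bullet> v\<bar> \<le> K / 2 * X * Y"
  proof (cases "X = 0 \<or> Y = 0")
    case True
    then have "u = 0 \<or> v = 0" using bound[of 1 0] bound[of 0 1] by auto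
    then show ?thesis using True by auto
  next
    case False
    then have pos: "0 < X * Y" using nonneg by (simp add: less_le)
    \<comment> \<open>The weights \<alpha> = \<open>Y\<close> and \<beta> = \<open>X\<close> or
      \<open>- X\<close> balance the two terms of the polarized bound; the two signs give the
      absolute value.\<close>
    have "(X * Y) * \<bar>u \<bullet> v\<bar> \<le> (X * Y) * (K / 2 * X * Y)"
      using polar[of Y X] polar[of Y "- X"] nonneg
      by (auto simp: abs_if power2_eq_square algebra_simps)
    then show ?thesis using pos by (simp only: mult_le_cancel_left_pos)
  qed
  then show ?thesis by (simp add: u_def v_def X_def Y_def)
qed

text \<open>Halving the index set costs one off-diagonal block, and after \<open>s\<close> halvings the remaining
  triangles are small enough for the Frobenius bound.\<close>

lemma strict_lower_gram_le:
  fixes a :: "'i::linorder \<Rightarrow> 'v::real_inner"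
  assumes a: "\<And>i. norm (a i) \<le> 1"
    and K: "\<And>T z. finite T \<Longrightarrow> (norm (\<Sum>i\<in>T. z i *\<^sub>R a i))\<^sup>2 \<le> K * (L2_set z T)\<^sup>2"
    and p: "real p \<le> K"
    and "finite S" "card S \<le> 2 ^ s * Suc p"
  shows "\<bar>strict_lower_form (\<lambda>i j. a i \<bullet> a j) S x y\<bar> \<le> (1 + real s / 2) * K * L2_set x S * L2_set y S"
  using assms(4,5)
proof (induction s arbitrary: S)
  case 0
  have "\<bar>a i \<bullet> a j\<bar> \<le> 1" for i j
    using Cauchy_Schwarz_ineq2[of "a i" "a j"] a[of i] a[of j]
    by (meson mult_le_one norm_ge_zero order_trans)
  then have "\<bar>strict_lower_form (\<lambda>i j. a i \<bullet> a j) S x y\<bar> \<le> real p * L2_set x S * L2_set y S"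
    using 0 by (intro strict_lower_form_le) auto
  also have "\<dots> \<le> K * L2_set x S * L2_set y S"
    using p by (intro mult_right_mono) (auto simp: L2_set_nonneg)
  finally show ?case by simp
next
  case (Suc s)
  \<comment> \<open>The initial segment takes as many indices as the induction hypothesis allows.
    The remainder then fits too, and is empty when \<open>S\<close> is already small.\<close>
  define k where "k = min (card S) (2 ^ s * Suc p)"
  obtain T where T: "T \<subseteq> S" "card T = k" and less: "\<forall>t\<in>T. \<forall>u\<in>S - T. t < u"
    using exists_initial_segment[OF Suc.prems(1), of k] by (auto simp: k_def)
  define U where "U = S - T"
  have finT: "finite T" and finU: "finite U" using T Suc.prems(1) finite_subset by (auto simp: U_def)
  have S: "S = T \<union> U" "T \<inter> U = {}" using T by (auto simp: U_def)
  have cardT: "card T \<le> 2 ^ s * Suc p" using T by (simp add: k_def)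
  have cardU: "card U \<le> 2 ^ s * Suc p"
    using T Suc.prems finT by (simp add: U_def card_Diff_subset k_def)
  let ?f = "strict_lower_form (\<lambda>i j. a i \<bullet> a j)"
  let ?c = "(1 + real s / 2) * K"
  let ?XT = "L2_set x T" and ?XU = "L2_set x U" and ?YT = "L2_set y T" and ?YU = "L2_set y U"
  let ?X = "L2_set x S" and ?Y = "L2_set y S"
  have K0: "0 \<le> K" using p by (meson of_nat_0_le_iff order_trans)
  have nn: "0 \<le> ?XT" "0 \<le> ?XU" "0 \<le> ?YT" "0 \<le> ?YU" "0 \<le> ?X" "0 \<le> ?Y"
    by (simp_all add: L2_set_nonneg)
  have X: "?X\<^sup>2 = ?XT\<^sup>2 + ?XU\<^sup>2" and Y: "?Y\<^sup>2 = ?YT\<^sup>2 + ?YU\<^sup>2"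
    using finT finU S by (simp_all add: L2_set_power2 sum.union_disjoint)
  have "?f S x y = ?f T x y + ?f U x y + (\<Sum>i\<in>U. x i *\<^sub>R a i) \<bullet> (\<Sum>j\<in>T. y j *\<^sub>R a j)"
    unfolding S(1) using less by (intro strict_lower_form_Un finT finU) (auto simp: U_def)
  moreover have "\<bar>?f T x y\<bar> \<le> ?c * ?XT * ?YT" by (rule Suc.IH[OF finT cardT])
  moreover have "\<bar>?f U x y\<bar> \<le> ?c * ?XU * ?YU" by (rule Suc.IH[OF finU cardU])
  moreover have "\<bar>(\<Sum>i\<in>U. x i *\<^sub>R a i) \<bullet> (\<Sum>j\<in>T. y j *\<^sub>R a j)\<bar> \<le> K / 2 * ?XU * ?YT"
    using finT finU S by (intro abs_inner_block_le K) auto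
  ultimately have "\<bar>?f S x y\<bar> \<le> ?c * (?XT * ?YT + ?XU * ?YU) + K / 2 * (?XU * ?YT)"
    by (simp add: algebra_simps)
  also have "\<dots> \<le> ?c * (?X * ?Y) + K / 2 * (?X * ?Y)"
  proof (intro add_mono mult_left_mono)
    \<comment> \<open>The diagonal blocks act on disjoint coordinates, so Cauchy-Schwarz in the
      plane bounds both together with the single constant \<open>?c\<close>. Only the off-diagonal
      block adds \<open>K / 2\<close>.\<close>
    have "(?XT * ?YT + ?XU * ?YU)\<^sup>2 \<le> (?X * ?Y)\<^sup>2"
      using L2_set_mult_ineq_lemma[of ?XT ?YT ?XU ?YU]
      unfolding power_mult_distrib X Y
      by (simp add: power2_sum power_mult_distrib algebra_simps)
    then show "?XT * ?YT + ?XU * ?YU \<le> ?X * ?Y" using nn by (simp add: power2_le_iff_abs_le)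
    have "?XU\<^sup>2 \<le> ?X\<^sup>2" "?YT\<^sup>2 \<le> ?Y\<^sup>2" using X Y by simp_all
    then have "?XU \<le> ?X" "?YT \<le> ?Y" using nn power2_le_imp_le by blast+
    then show "?XU * ?YT \<le> ?X * ?Y" using nn by (intro mult_mono)
  qed (use K0 in auto)
  also have "\<dots> = (1 + real (Suc s) / 2) * K * ?X * ?Y" by (simp add: field_simps)
  finally show ?case .
qed

section \<open>One cycle of the Kaczmarz method\<close>

lemma normalize_rows_nth: "normalize_rows A $ i = A $ i /\<^sub>R norm (A $ i)"
  by (simp add: normalize_rows_def)

lemma norm_normalize_rows: "A $ i \<noteq> 0 \<Longrightarrow> norm (normalize_rows A $ i) = 1"
  by (simp add: normalize_rows_nth)

lemma normalize_rows_inner: "A $ i \<bullet> x = norm (A $ i) * (normalize_rows A $ i \<bullet> x)"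
  by (cases "A $ i = 0") (simp_all add: normalize_rows_nth)

text \<open>Normalizing the rows and undoing it are both left multiplications by diagonal matrices,
  and neither can raise the rank.\<close>

lemma rank_normalize_rows:
  fixes A :: "real^'n^'m"
  assumes "\<forall>i. A $ i \<noteq> 0"
  shows "rank (normalize_rows A) = rank A"
proof -
  define D where "D c = (\<chi> i j. if i = j then c i else (0::real))" for c :: "'m \<Rightarrow> real"
  have D: "D c ** B = (\<chi> i. c i *\<^sub>R B $ i)" for c and B :: "real^'n^'m"
    by (simp add: D_def matrix_matrix_mult_def vec_eq_iff if_distrib[of "\<lambda>x. x * _"] cong: if_cong)
  have "normalize_rows A = D (\<lambda>i. inverse (norm (A $ i))) ** A"
    by (simp add: D normalize_rows_def)
  then have "rank (normalize_rows A) \<le> rank A" by (metis rank_mul_le_right)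
  moreover have "A = D (\<lambda>i. norm (A $ i)) ** normalize_rows A"
    using assms by (simp add: D normalize_rows_nth vec_eq_iff)
  then have "rank A \<le> rank (normalize_rows A)" by (metis rank_mul_le_right)
  ultimately show ?thesis by simp
qed

lemma normalize_rows_mult_eq_0:
  assumes "\<forall>i. A $ i \<noteq> 0"
  shows "normalize_rows A *v w = 0 \<longleftrightarrow> A *v w = 0"
proof -
  have "A $ i \<bullet> w = 0 \<longleftrightarrow> normalize_rows A $ i \<bullet> w = 0" for i
    using assms by (simp only: normalize_rows_inner[of A] mult_eq_0_iff norm_eq_zero) simp
  then show ?thesis by (simp add: vec_eq_iff[of _ 0] matrix_vector_mul_component)
qed

lemma norm_matrix_vector_le_normalize_rows:
  fixes A :: "real^'n^'m"
  assumes "\<And>i. (norm (A $ i))\<^sup>2 \<le> M"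
  shows "(norm (A *v x))\<^sup>2 \<le> M * (norm (normalize_rows A *v x))\<^sup>2"
  unfolding norm_matrix_vector sum_distrib_left
  by (intro sum_mono) (simp add: normalize_rows_inner[of A] power_mult_distrib assms mult_right_mono)

lemma last_row_proj_mult:
  "last_row_proj A *v x = x - (normalize_rows A $ Max UNIV \<bullet> x) *\<^sub>R normalize_rows A $ Max UNIV"
proof -
  define u where "u = normalize_rows A $ Max UNIV"
  have "((columnvector u :: real^1^'a) ** (rowvector u :: real^'a^1)) *v x = (u \<bullet> x) *\<^sub>R u"
    by (simp add: vec_eq_iff columnvector_def rowvector_def matrix_matrix_mult_def
        matrix_vector_mult_def inner_vec_def sum_distrib_right sum_distrib_left mult_ac)
  then show ?thesis
    by (simp add: last_row_proj_def Let_def u_def matrix_vector_mult_diff_rdistrib)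
qed

lemma norm_diff_proj:
  fixes u x :: "'a::real_inner"
  assumes "norm u = 1"
  shows "(norm (x - (u \<bullet> x) *\<^sub>R u))\<^sup>2 = (norm x)\<^sup>2 - (u \<bullet> x)\<^sup>2"
proof -
  have "u \<bullet> u = 1" using assms by (simp add: dot_square_norm)
  then show ?thesis
    unfolding power2_norm_eq_inner
    by (simp add: inner_diff_left inner_diff_right inner_commute power2_eq_square)
qed

text \<open>Eliminating the rows one by one, \<open>y\<^sub>i\<close> is the residual of row \<open>i\<close> at the moment it is visited;
  this residual then vanishes and only the later rows contribute to it again.\<close>

lemma fold_projections:
  fixes a :: "'i::linorder \<Rightarrow> 'v::real_inner"
  assumes a: "\<And>i. norm (a i) = 1" and "sorted_wrt (<) l"
  defines "f \<equiv> \<lambda>i e. e - (a i \<bullet> e) *\<^sub>R a i"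
  shows "\<exists>y. fold f l e = e - (\<Sum>i\<in>set l. y i *\<^sub>R a i)
    \<and> (norm (fold f l e))\<^sup>2 = (norm e)\<^sup>2 - (\<Sum>i\<in>set l. (y i)\<^sup>2)
    \<and> (\<forall>i\<in>set l. a i \<bullet> fold f l e = - (\<Sum>j\<in>{j\<in>set l. i < j}. y j * (a j \<bullet> a i)))"
  using assms(2)
proof (induction l arbitrary: e)
  case (Cons i l)
  define c where "c = a i \<bullet> e"
  define e\<^sub>1 where "e\<^sub>1 = f i e"
  have e1: "e\<^sub>1 = e - c *\<^sub>R a i" by (simp add: e\<^sub>1_def f_def c_def)
  have fold: "fold f (i # l) e = fold f l e\<^sub>1" by (simp add: e\<^sub>1_def)
  obtain y where
      y: "fold f l e\<^sub>1 = e\<^sub>1 - (\<Sum>j\<in>set l. y j *\<^sub>R a j)"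
    and norm: "(norm (fold f l e\<^sub>1))\<^sup>2 = (norm e\<^sub>1)\<^sup>2 - (\<Sum>j\<in>set l. (y j)\<^sup>2)"
    and res: "\<And>k. k \<in> set l \<Longrightarrow>
      a k \<bullet> fold f l e\<^sub>1 = - (\<Sum>j\<in>{j\<in>set l. k < j}. y j * (a j \<bullet> a k))"
    using Cons.IH[of e\<^sub>1] Cons.prems by auto
  define y' where "y' = y(i := c)"
  have less: "i < j" if "j \<in> set l" for j using Cons.prems that by simp
  then have notin: "i \<notin> set l" by blast
  have y'_l: "y' j = y j" if "j \<in> set l" for j using that notin by (auto simp: y'_def)
  have y'_i: "y' i = c" by (simp add: y'_def)
  have "fold f (i # l) e = e - (\<Sum>j\<in>set (i # l). y' j *\<^sub>R a j)"
    unfolding fold y using notin by (simp add: e1 y'_l y'_i cong: sum.cong)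
  moreover have "(norm (fold f (i # l) e))\<^sup>2 = (norm e)\<^sup>2 - (\<Sum>j\<in>set (i # l). (y' j)\<^sup>2)"
    unfolding fold norm using notin norm_diff_proj[OF a[of i], of e]
    by (simp add: e1 y'_l y'_i c_def cong: sum.cong)
  moreover have "a k \<bullet> fold f (i # l) e = - (\<Sum>j\<in>{j\<in>set (i # l). k < j}. y' j * (a j \<bullet> a k))"
    if k: "k \<in> set (i # l)" for k
  proof (cases "k = i")
    case True
    have "{j \<in> set (i # l). i < j} = set l" using less by auto
    moreover have "a i \<bullet> e\<^sub>1 = 0"
      using a[of i] by (simp add: e1 c_def inner_diff_right dot_square_norm)
    ultimately show ?thesis
      unfolding True fold y by (simp add: inner_diff_right inner_sum_right y'_l inner_commute cong: sum.cong)
  next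
    case False
    then have kl: "k \<in> set l" using k by simp
    \<comment> \<open>The row \<open>i\<close> precedes \<open>k\<close>, so its coefficient does
      not enter the final residual of row \<open>k\<close>.\<close>
    then have later: "{j \<in> set (i # l). k < j} = {j \<in> set l. k < j}" using less by force
    show ?thesis
      unfolding fold res[OF kl] later
      by (intro arg_cong[of _ _ uminus] sum.cong) (auto simp: y'_l)
  qed
  ultimately show ?case by blast
qed simp

text \<open>Relative to any solution \<open>z\<close>, a step is the orthogonal projection of the
  error along the unit row, since \<open>b $ i\<close> is the inner product of that row of
  \<open>A\<close> with \<open>z\<close>.\<close>

lemma kaczmarz_step_error:
  assumes "A *v z = b"
  shows "kaczmarz_step A b i x - z
    = (x - z) - (normalize_rows A $ i \<bullet> (x - z)) *\<^sub>R normalize_rows A $ i"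
proof -
  have "b $ i = A $ i \<bullet> z" using assms by (auto simp: matrix_vector_mul_component)
  then show ?thesis
    by (simp add: kaczmarz_step_def normalize_rows_nth inner_diff_right power2_eq_square
        divide_inverse algebra_simps)
qed

lemma kaczmarz_cycle_error:
  fixes A :: "real^'n^'m::{finite,linorder}"
  assumes "A *v z = b"
  shows "kaczmarz_cycle A b x - z
    = fold (\<lambda>i e. e - (normalize_rows A $ i \<bullet> e) *\<^sub>R normalize_rows A $ i) (sorted_list_of_set UNIV) (x - z)"
proof -
  have "fold (kaczmarz_step A b) l x - z
    = fold (\<lambda>i e. e - (normalize_rows A $ i \<bullet> e) *\<^sub>R normalize_rows A $ i) l (x - z)" for l
    by (induction l arbitrary: x) (simp_all add: kaczmarz_step_error[OF assms])
  then show ?thesis by (simp add: kaczmarz_cycle_def)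
qed

text \<open>Matrix form of \<open>fold_projections\<close>. Only strictly later rows disturb a row
  already visited, hence the transpose of \<open>L - I\<close>; nothing follows the last row, so its
  residual is zero.\<close>

lemma kaczmarz_cycle_factorization:
  fixes A :: "real^'n^'m::{finite,linorder}" and x z :: "real^'n"
  assumes "\<forall>i. A $ i \<noteq> 0" and z: "A *v z = b"
  defines "e \<equiv> x - z" and "e' \<equiv> kaczmarz_cycle A b x - z"
  obtains y where "e' = e - transpose (normalize_rows A) *v y"
    "(norm e')\<^sup>2 = (norm e)\<^sup>2 - (norm y)\<^sup>2"
    "normalize_rows A *v e' = - (transpose (lower_gram A - mat 1) *v y)"
    "normalize_rows A $ Max UNIV \<bullet> e' = 0"
proof -
  let ?a = "\<lambda>i. normalize_rows A $ i"
  let ?l = "sorted_list_of_set UNIV :: 'm list"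
  obtain y where "e' = e - (\<Sum>i\<in>set ?l. y i *\<^sub>R ?a i)"
    "(norm e')\<^sup>2 = (norm e)\<^sup>2 - (\<Sum>i\<in>set ?l. (y i)\<^sup>2)"
    "\<forall>i\<in>set ?l. ?a i \<bullet> e' = - (\<Sum>j\<in>{j\<in>set ?l. i < j}. y j * (?a j \<bullet> ?a i))"
    using fold_projections[of ?a ?l e, OF norm_normalize_rows[OF spec[OF assms(1)]]
        strict_sorted_list_of_set]
    unfolding e'_def e_def kaczmarz_cycle_error[OF z] by blast
  then have y: "e' = e - (\<Sum>i\<in>UNIV. y i *\<^sub>R ?a i)"
    "(norm e')\<^sup>2 = (norm e)\<^sup>2 - (\<Sum>i\<in>UNIV. (y i)\<^sup>2)"
    "\<And>i. ?a i \<bullet> e' = - (\<Sum>j\<in>{j. i < j}. y j * (?a j \<bullet> ?a i))"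
    by simp_all
  let ?y = "\<chi> i. y i"
  have "transpose (normalize_rows A) *v ?y = (\<Sum>i\<in>UNIV. y i *\<^sub>R ?a i)"
    by (simp add: vec_eq_iff matrix_vector_mult_def transpose_def mult.commute)
  moreover have "(norm ?y)\<^sup>2 = (\<Sum>i\<in>UNIV. (y i)\<^sup>2)"
    by (simp add: norm_power2_vec)
  moreover have "normalize_rows A *v e' = - (transpose (lower_gram A - mat 1) *v ?y)"
  proof -
    have "(\<Sum>j\<in>UNIV. (lower_gram A - mat 1) $ j $ i * y j)
      = (\<Sum>j\<in>{j. i < j}. y j * (?a j \<bullet> ?a i))" for i
    proof -
      have "(\<Sum>j\<in>UNIV. (lower_gram A - mat 1) $ j $ i * y j)
        = (\<Sum>j\<in>UNIV. if i < j then y j * (?a j \<bullet> ?a i) else 0)"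
        by (rule sum.cong) (auto simp: lower_gram_def mat_def)
      then show ?thesis by (simp add: sum.If_cases)
    qed
    then have "(transpose (lower_gram A - mat 1) *v ?y) $ i
      = (\<Sum>j\<in>{j. i < j}. y j * (?a j \<bullet> ?a i))" for i
      unfolding matrix_vector_mult_def transpose_def vec_lambda_beta .
    then show ?thesis
      by (simp only: vec_eq_iff matrix_vector_mul_component y(3) uminus_vec_def vec_lambda_beta) simp
  qed
  moreover have "{j. Max UNIV < j} = ({} :: 'm set)"
    using Max_ge[of "UNIV :: 'm set"] by (auto dest: leD)
  then have "?a (Max UNIV) \<bullet> e' = 0"
    by (simp only: y(3)) simp
  ultimately show thesis using that[of ?y] y(1,2) by simp
qed

text \<open>The squared norm of \<open>y\<close> is exactly the drop of the squared error, which
  yields the first bound. The other two facts hold because the last-row projection fixes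
  \<open>e'\<close> and because a cycle changes the error only by combinations of rows.\<close>

lemma kaczmarz_cycle_residual:
  fixes A :: "real^'n^'m::{finite,linorder}" and x z :: "real^'n"
  assumes rows: "\<forall>i. A $ i \<noteq> 0" and z: "A *v z = b"
    and perp: "\<And>w. A *v w = 0 \<Longrightarrow> (x - z) \<bullet> w = 0"
  defines "e \<equiv> x - z" and "e' \<equiv> kaczmarz_cycle A b x - z"
  shows "(norm (normalize_rows A *v e'))\<^sup>2
      \<le> (op_norm (lower_gram A - mat 1))\<^sup>2 * ((norm e)\<^sup>2 - (norm e')\<^sup>2)"
    and "(norm (A *v e'))\<^sup>2 \<le> (op_norm (A ** last_row_proj A))\<^sup>2 * (norm e')\<^sup>2"
    and "\<And>w. A *v w = 0 \<Longrightarrow> e' \<bullet> w = 0"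
proof -
  obtain y where y: "e' = e - transpose (normalize_rows A) *v y"
    "(norm e')\<^sup>2 = (norm e)\<^sup>2 - (norm y)\<^sup>2"
    "normalize_rows A *v e' = - (transpose (lower_gram A - mat 1) *v y)"
    "normalize_rows A $ Max UNIV \<bullet> e' = 0"
    using kaczmarz_cycle_factorization[OF rows z] unfolding e_def e'_def by metis
  have "norm (normalize_rows A *v e') \<le> op_norm (lower_gram A - mat 1) * norm y"
    unfolding y(3) norm_minus_cancel by (intro norm_transpose_le norm_le_op_norm)
  then have "(norm (normalize_rows A *v e'))\<^sup>2 \<le> (op_norm (lower_gram A - mat 1) * norm y)\<^sup>2"
    by (intro power_mono) auto
  then show "(norm (normalize_rows A *v e'))\<^sup>2
      \<le> (op_norm (lower_gram A - mat 1))\<^sup>2 * ((norm e)\<^sup>2 - (norm e')\<^sup>2)"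
    by (simp add: power_mult_distrib y(2))
  have "A *v e' = (A ** last_row_proj A) *v e'"
    by (simp add: last_row_proj_mult y(4) flip: matrix_vector_mul_assoc)
  then have "norm (A *v e') \<le> op_norm (A ** last_row_proj A) * norm e'"
    by (metis norm_le_op_norm)
  then have "(norm (A *v e'))\<^sup>2 \<le> (op_norm (A ** last_row_proj A) * norm e')\<^sup>2"
    by (intro power_mono) auto
  then show "(norm (A *v e'))\<^sup>2 \<le> (op_norm (A ** last_row_proj A))\<^sup>2 * (norm e')\<^sup>2"
    by (simp add: power_mult_distrib)
  show "e' \<bullet> w = 0" if "A *v w = 0" for w
    using perp[OF that] normalize_rows_mult_eq_0[OF rows, of w] that
    by (simp add: y(1) e_def[symmetric] inner_diff_left dot_lmul_matrix)
qed

section \<open>Bounds on the constants\<close>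

lemma op_norm_lower_gram_frobenius:
  fixes A :: "real^'n^'m::{finite,linorder}"
  shows "(op_norm (lower_gram A - mat 1))\<^sup>2
    \<le> (\<Sum>(i, j)\<in>{(i, j). i < j}. (normalize_rows A $ i \<bullet> normalize_rows A $ j)\<^sup>2)"
proof -
  let ?g = "\<lambda>i j. (normalize_rows A $ i \<bullet> normalize_rows A $ j)\<^sup>2"
  have "(\<Sum>i\<in>UNIV. (norm ((lower_gram A - mat 1) $ i))\<^sup>2)
    = (\<Sum>i\<in>UNIV. \<Sum>j\<in>UNIV. if j < i then ?g j i else 0)"
    unfolding norm_power2_vec
    by (intro sum.cong refl) (auto simp: lower_gram_def mat_def inner_commute)
  \<comment> \<open>Exchanging the sums reindexes the entries below the diagonal as pairs whose
    first index is the smaller one.\<close>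
  also have "\<dots> = (\<Sum>j\<in>UNIV. \<Sum>i\<in>UNIV. if j < i then ?g j i else 0)"
    by (rule sum.swap)
  also have "\<dots> = (\<Sum>(j, i)\<in>UNIV. if j < i then ?g j i else 0)"
    by (simp add: sum.cartesian_product)
  also have "\<dots> = (\<Sum>(j, i)\<in>{(j, i). j < i}. ?g j i)"
    by (rule sum.mono_neutral_cong_right) (auto split: if_splits)
  finally show ?thesis using op_norm_le_frobenius[of "lower_gram A - mat 1"] by simp
qed

lemma op_norm_lower_gram_rank:
  fixes A :: "real^'n^'m::{finite,linorder}"
  assumes rows: "\<forall>i. A $ i \<noteq> 0"
  shows "op_norm (lower_gram A - mat 1)
    \<le> (1 + real_of_int \<lceil>log 2 (real (rank A))\<rceil> / 2) * (singular_value (normalize_rows A) 1)\<^sup>2"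
proof -
  let ?B = "normalize_rows A" and ?M = "lower_gram A - mat 1"
  define r where "r = rank A"
  define K where "K = (singular_value ?B 1)\<^sup>2"
  have norm1: "norm (?B $ i) = 1" for i using rows by (simp add: norm_normalize_rows)
  have B0: "?B \<noteq> 0" using norm1 by force
  have rankB: "rank ?B = r" using rows by (simp add: rank_normalize_rows r_def)
  have r: "0 < r" using B0 rankB rank_eq_0 by (metis gr0I)
  \<comment> \<open>Subtracting one before dividing gives \<open>CARD('m) \<le> r * Suc p\<close>,
    while \<open>r * p \<le> CARD('m)\<close> still holds. The first covers all rows after
    \<open>s\<close> halvings, the second yields \<open>p \<le> K\<close> by the trace.\<close>
  define p where "p = (CARD('m) - 1) div r"
  define s where "s = nat \<lceil>log 2 (real r)\<rceil>"
  \<comment> \<open>The conversion by \<open>nat\<close> loses nothing, since the rank is at least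
    one and its logarithm nonnegative.\<close>
  have log: "real s = real_of_int \<lceil>log 2 (real r)\<rceil>"
    using r by (simp add: s_def)
  have "real r = 2 powr log 2 (real r)" using r by simp
  also have "\<dots> \<le> 2 powr real s" unfolding log by (intro powr_mono) auto
  finally have "real r \<le> real (2 ^ s)" by (simp add: powr_realpow)
  then have r_le: "r \<le> 2 ^ s" by (simp only: of_nat_le_iff)
  have "CARD('m) - 1 < r * Suc p"
    using r by (simp add: p_def dividend_less_times_div)
  then have "CARD('m) \<le> r * Suc p" by simp
  also have "\<dots> \<le> 2 ^ s * Suc p" using r_le by (rule mult_le_mono1)
  finally have card: "CARD('m) \<le> 2 ^ s * Suc p" .
  have "real r * real p \<le> real CARD('m)"
  proof -
    have "r * p \<le> CARD('m)" by (simp add: p_def order_trans[OF times_div_less_eq_dividend])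
    then show ?thesis by (metis of_nat_le_iff of_nat_mult)
  qed
  also have "\<dots> \<le> real r * K"
    using frobenius_le_rank[of ?B] by (simp add: norm1 rankB K_def)
  finally have p: "real p \<le> K" using r by simp
  \<comment> \<open>Padding the coefficients by zero turns a partial combination of rows into a
    value of the transpose, which obeys the same norm bound as \<open>?B\<close>.\<close>
  have K: "(norm (\<Sum>i\<in>T. z i *\<^sub>R ?B $ i))\<^sup>2 \<le> K * (L2_set z T)\<^sup>2" for T z
  proof -
    let ?z = "\<chi> i. if i \<in> T then z i else 0"
    have "(\<Sum>i\<in>T. z i *\<^sub>R ?B $ i) = transpose ?B *v ?z"
      by (simp add: vec_eq_iff matrix_vector_mult_def transpose_def mult.commute if_distrib
          sum.If_cases cong: if_cong)
    moreover have "(norm ?z)\<^sup>2 = (L2_set z T)\<^sup>2"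
      by (simp add: norm_power2_vec L2_set_power2 if_distrib[of "\<lambda>x. x\<^sup>2"] sum.If_cases cong: if_cong)
    moreover have "(norm (transpose ?B *v ?z))\<^sup>2 \<le> (singular_value ?B 1 * norm ?z)\<^sup>2"
      by (intro power_mono norm_transpose_le norm_le_singular_value B0) auto
    ultimately show ?thesis by (simp add: K_def power_mult_distrib)
  qed
  have L2: "L2_set (($) v) UNIV = norm v" for v :: "real^'m::{finite,linorder}"
    by (simp add: norm_vec_def L2_set_def)
  have "norm (?M *v y) \<le> (1 + real s / 2) * K * norm y" for y
  proof -
    let ?w = "?M *v y" and ?c = "(1 + real s / 2) * K"
    have w: "?w $ i = (\<Sum>j\<in>{j. j < i}. (?B $ i \<bullet> ?B $ j) * y $ j)" for i
    proof -
      have "?w $ i = (\<Sum>j\<in>UNIV. if j < i then (?B $ i \<bullet> ?B $ j) * y $ j else 0)"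
        unfolding matrix_vector_mult_def vec_lambda_beta
        by (rule sum.cong) (auto simp: lower_gram_def mat_def)
      then show ?thesis by (simp add: sum.If_cases)
    qed
    \<comment> \<open>Testing the bilinear form with the image \<open>?w\<close> itself converts the
      form bound into a norm bound.\<close>
    have "norm ?w * norm ?w = (\<Sum>i\<in>UNIV. ?w $ i * ?w $ i)"
      by (simp only: norm_power2_vec flip: power2_eq_square)
    also have "\<dots> = strict_lower_form (\<lambda>i j. ?B $ i \<bullet> ?B $ j) UNIV (($) ?w) (($) y)"
      unfolding strict_lower_form_def
      by (subst (2) w) (simp add: sum_distrib_left mult_ac)
    also have "\<dots> \<le> ?c * norm ?w * norm y"
      using strict_lower_gram_le[of "($) ?B" K p UNIV s "($) ?w" "($) y"] norm1 K p card
      by (simp add: L2)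
    finally have *: "norm ?w * norm ?w \<le> norm ?w * (?c * norm y)" by (simp add: mult_ac)
    show ?thesis
    proof (cases "norm ?w = 0")
      case True
      have "0 \<le> K" by (simp add: K_def)
      then show ?thesis using True by simp
    next
      case False
      then show ?thesis using * by (simp only: mult_le_cancel_left) simp
    qed
  qed
  then have "op_norm ?M \<le> (1 + real s / 2) * K" by (rule op_norm_leI)
  then show ?thesis by (simp add: log K_def r_def)
qed

text \<open>Each row of the product is a row of \<open>A\<close> without its component along the
  last unit row; Pythagoras gives its length and the Frobenius bound finishes.\<close>

lemma op_norm_last_row_proj_frobenius:
  fixes A :: "real^'n^'m::{finite,linorder}"
  assumes rows: "\<forall>i. A $ i \<noteq> 0"
  shows "(op_norm (A ** last_row_proj A))\<^sup>2 \<le> (\<Sum>i\<in>UNIV. (norm (A $ i))\<^sup>2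
    * (1 - (normalize_rows A $ i \<bullet> normalize_rows A $ Max UNIV)\<^sup>2))"
proof -
  let ?u = "normalize_rows A $ Max UNIV"
  have u: "norm ?u = 1" using rows by (simp add: norm_normalize_rows)
  have row: "(A ** last_row_proj A) $ i = A $ i - (?u \<bullet> A $ i) *\<^sub>R ?u" for i
  proof -
    have "(A ** last_row_proj A) $ i \<bullet> v = (A $ i - (?u \<bullet> A $ i) *\<^sub>R ?u) \<bullet> v" for v
    proof -
      have "(A ** last_row_proj A) $ i \<bullet> v = (A *v (last_row_proj A *v v)) $ i"
        by (simp only: matrix_vector_mul_assoc matrix_vector_mul_component)
      also have "\<dots> = A $ i \<bullet> (v - (?u \<bullet> v) *\<^sub>R ?u)"
        by (simp only: matrix_vector_mul_component last_row_proj_mult)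
      finally show ?thesis by (simp add: inner_diff_left inner_diff_right inner_commute)
    qed
    then show ?thesis by (metis vector_eq_rdot)
  qed
  have "(norm ((A ** last_row_proj A) $ i))\<^sup>2 = (norm (A $ i))\<^sup>2 * (1 - (normalize_rows A $ i \<bullet> ?u)\<^sup>2)"
    for i
    unfolding row norm_diff_proj[OF u]
    by (simp add: inner_commute[of ?u] normalize_rows_inner[of A] power_mult_distrib algebra_simps)
  then show ?thesis using op_norm_le_frobenius[of "A ** last_row_proj A"] by simp
qed

text \<open>An orthogonal projection does not increase norms, so composing \<open>A\<close> with it
  keeps the bound by the largest singular value.\<close>

lemma op_norm_last_row_proj_singular_value:
  fixes A :: "real^'n^'m::{finite,linorder}"
  assumes rows: "\<forall>i. A $ i \<noteq> 0"
  shows "op_norm (A ** last_row_proj A) \<le> singular_value A 1"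
proof (rule op_norm_leI)
  fix x
  let ?u = "normalize_rows A $ Max UNIV"
  have u: "norm ?u = 1" using rows by (simp add: norm_normalize_rows)
  have A0: "A \<noteq> 0" using rows by force
  have "1 \<le> rank A" using A0 rank_eq_0[of A] by (simp add: Suc_le_eq)
  then have pos: "0 < singular_value A 1" by (intro singular_value_pos) auto
  have "(norm (last_row_proj A *v x))\<^sup>2 \<le> (norm x)\<^sup>2"
    by (simp add: last_row_proj_mult norm_diff_proj[OF u])
  then have le: "norm (last_row_proj A *v x) \<le> norm x"
    using norm_ge_zero power2_le_imp_le by blast
  have "norm ((A ** last_row_proj A) *v x) \<le> singular_value A 1 * norm (last_row_proj A *v x)"
    using norm_le_singular_value[OF A0] by (simp flip: matrix_vector_mul_assoc)
  also have "\<dots> \<le> singular_value A 1 * norm x" using le pos by simp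
  finally show "norm ((A ** last_row_proj A) *v x) \<le> singular_value A 1 * norm x" .
qed

section \<open>The residual bound\<close>

text \<open>The solution set is an affine space, so the variational inequality of the closest point
  applies in the directions \<open>w\<close> and \<open>- w\<close> alike and becomes an
  equality.\<close>

lemma closest_solution_orthogonal:
  fixes A :: "real^'n^'m" and x :: "real^'n"
  assumes "b \<in> range ((*v) A)"
  defines "xs \<equiv> closest_point {z. A *v z = b} x"
  shows "A *v xs = b" and "A *v w = 0 \<Longrightarrow> (x - xs) \<bullet> w = 0"
proof -
  let ?S = "{z. A *v z = b}"
  have ne: "?S \<noteq> {}" using assms(1) by auto
  have cl: "closed ?S"
    by (intro closed_Collect_eq linear_continuous_on continuous_on_const) simp
  have cv: "convex ?S"
    by (auto simp: convex_def matrix_vector_right_distrib matrix_vector_mult_scaleR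
        simp flip: scaleR_add_left)
  show xs: "A *v xs = b" using closest_point_in_set[OF cl ne] by (simp add: xs_def)
  show "(x - xs) \<bullet> w = 0" if "A *v w = 0"
  proof -
    have "(x - xs) \<bullet> v \<le> 0" if "A *v v = 0" for v
      using closest_point_dot[OF cv cl, of "xs + v" x] xs that
      by (simp add: xs_def[symmetric] matrix_vector_right_distrib)
    from this[of w] this[of "- w"] that show ?thesis
      by (simp add: vec.neg)
  qed
qed

theorem corollary1:
  fixes A :: "real^'n^'m::{finite,linorder}" and b :: "real^'m::{finite,linorder}" and x\<^sub>0 :: "real^'n"
  assumes nonzero_rows: "\<forall>i. A $ i \<noteq> 0"
    and consistent: "b \<in> range ((*v) A)"
  shows
    "let r = rank A;
         Ahat = normalize_rows A;
         l2 = (op_norm (lower_gram A - mat 1))\<^sup>2;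
         p2 = (op_norm (A ** last_row_proj A))\<^sup>2;
         M = Max (range (\<lambda>i. (norm (A $ i))\<^sup>2));
         q = l2 / (l2 + (singular_value Ahat r)\<^sup>2);
         x = kaczmarz A b x\<^sub>0;
         xs = closest_point {z. A *v z = b} x\<^sub>0
     in 0 \<le> q \<and> q < 1
      \<and> (\<forall>k. (norm (A *v x k - b))\<^sup>2 = (norm (A *v (x k - xs)))\<^sup>2)
      \<and> (\<forall>k\<ge>1. (norm (A *v x k - b))\<^sup>2
            \<le> min (M * l2 * p2 / (p2 + M * l2) * q ^ (k - 1)) (p2 * q ^ k)
               * (norm (x\<^sub>0 - xs))\<^sup>2)
      \<and> p2 \<le> min (\<Sum>i\<in>UNIV. (norm (A $ i))\<^sup>2 * (1 - (Ahat $ i \<bullet> Ahat $ Max UNIV)\<^sup>2))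
                 ((singular_value A 1)\<^sup>2)
      \<and> l2 \<le> min (\<Sum>(i, j)\<in>{(i, j). i < j}. (Ahat $ i \<bullet> Ahat $ j)\<^sup>2)
                 ((1 + real_of_int \<lceil>log 2 (real r)\<rceil> / 2)\<^sup>2 * (singular_value Ahat 1) ^ 4)"
proof -
  define B where "B = normalize_rows A"
  define l2 where "l2 = (op_norm (lower_gram A - mat 1))\<^sup>2"
  define p2 where "p2 = (op_norm (A ** last_row_proj A))\<^sup>2"
  define M where "M = Max (range (\<lambda>i. (norm (A $ i))\<^sup>2))"
  define \<sigma> where "\<sigma> = (singular_value B (rank A))\<^sup>2"
  define q where "q = l2 / (l2 + \<sigma>)"
  define xs where "xs = closest_point {z. A *v z = b} x\<^sub>0"
  define e where "e k = kaczmarz A b x\<^sub>0 k - xs" for k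
  have rankB: "rank B = rank A"
    using rank_normalize_rows[OF nonzero_rows] by (simp add: B_def)
  have "norm (B $ undefined) = 1" using nonzero_rows by (simp add: B_def norm_normalize_rows)
  then have B0: "B \<noteq> 0" by force
  then have "1 \<le> rank B" using rank_eq_0[of B] by (simp add: Suc_le_eq)
  then have sigma: "0 < \<sigma>"
    using singular_value_pos[of "rank B" B] by (simp add: \<sigma>_def rankB)
  have l2: "0 \<le> l2" and p2: "0 \<le> p2" by (simp_all add: l2_def p2_def)
  have q: "0 \<le> q" "q < 1" using l2 sigma by (simp_all add: q_def)
  have M_ge: "(norm (A $ i))\<^sup>2 \<le> M" for i unfolding M_def by (intro Max_ge) auto
  then have M: "0 \<le> M" by (meson order_trans zero_le_power2)
  have xs: "A *v xs = b" and perp0: "\<And>w. A *v w = 0 \<Longrightarrow> (x\<^sub>0 - xs) \<bullet> w = 0"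
    using closest_solution_orthogonal[OF consistent] by (auto simp: xs_def)
  have perp: "A *v w = 0 \<Longrightarrow> e k \<bullet> w = 0" for k w
  proof (induction k arbitrary: w)
    case 0
    then show ?case using perp0 by (simp add: e_def)
  next
    case (Suc k)
    then show ?case
      using kaczmarz_cycle_residual(3)[OF nonzero_rows xs, of "kaczmarz A b x\<^sub>0 k" w]
      by (simp add: e_def)
  qed
  have step: "(norm (B *v e (Suc k)))\<^sup>2 \<le> l2 * ((norm (e k))\<^sup>2 - (norm (e (Suc k)))\<^sup>2)"
    "(norm (A *v e (Suc k)))\<^sup>2 \<le> p2 * (norm (e (Suc k)))\<^sup>2" for k
    using kaczmarz_cycle_residual(1,2)[OF nonzero_rows xs perp[of _ k, unfolded e_def]]
    by (simp_all add: e_def B_def l2_def p2_def)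
  have contraction: "(norm (e (Suc k)))\<^sup>2 \<le> q * (norm (e k))\<^sup>2" for k
  proof -
    have "\<sigma> * (norm (e (Suc k)))\<^sup>2 \<le> (norm (B *v e (Suc k)))\<^sup>2"
      using singular_value_le_norm[OF _ B0, of "e (Suc k)"] perp[of _ "Suc k"]
        normalize_rows_mult_eq_0[OF nonzero_rows]
      by (simp add: \<sigma>_def rankB B_def[symmetric])
    \<comment> \<open>The residual is squeezed between \<sigma> times the new squared error and
      \<open>l2\<close> times the drop of the squared error.\<close>
    with step(1)[of k] have "(l2 + \<sigma>) * (norm (e (Suc k)))\<^sup>2 \<le> l2 * (norm (e k))\<^sup>2"
      by (simp add: algebra_simps)
    then show ?thesis using l2 sigma by (simp add: q_def field_simps)
  qed
  have decay: "(norm (e k))\<^sup>2 \<le> q ^ k * (norm (e 0))\<^sup>2" for k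
  proof (induction k)
    case (Suc k)
    then have "q * (norm (e k))\<^sup>2 \<le> q * (q ^ k * (norm (e 0))\<^sup>2)" using q by (intro mult_left_mono)
    then show ?case using contraction[of k] by (simp add: mult.assoc)
  qed simp
  have residual: "A *v kaczmarz A b x\<^sub>0 k - b = A *v e k" for k
    by (simp add: e_def matrix_vector_mult_diff_distrib xs)
  have bound: "(norm (A *v e k))\<^sup>2
      \<le> min (M * l2 * p2 / (p2 + M * l2) * q ^ (k - 1)) (p2 * q ^ k) * (norm (e 0))\<^sup>2"
    if k1: "1 \<le> k" for k
  proof -
    obtain j where k: "k = Suc j" using k1 by (cases k) auto
    let ?R = "(norm (A *v e k))\<^sup>2" and ?C = "M * l2 * p2 / (p2 + M * l2)"
    have Ml2: "0 \<le> M * l2" using M l2 by simp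
    have R2: "?R \<le> p2 * (norm (e k))\<^sup>2" using step(2) k by simp
    have "?R \<le> M * (norm (B *v e k))\<^sup>2"
      unfolding B_def by (rule norm_matrix_vector_le_normalize_rows) (rule M_ge)
    also have "\<dots> \<le> M * (l2 * ((norm (e j))\<^sup>2 - (norm (e k))\<^sup>2))"
      using step(1) M k by (intro mult_left_mono) auto
    finally have R1: "?R \<le> M * l2 * ((norm (e j))\<^sup>2 - (norm (e k))\<^sup>2)" by (simp add: mult.assoc)
    have "?R \<le> ?C * (norm (e j))\<^sup>2"
    proof (cases "p2 + M * l2 = 0")
      \<comment> \<open>Division by zero gives 0, in line with the stated convention; here
        \<open>p2 = 0\<close> makes the residual vanish as well.\<close>
      case True
      then have "p2 = 0" using p2 Ml2 by linarith
      then show ?thesis using R2 by simp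
    next
      case False
      then have pos: "0 < p2 + M * l2" using p2 Ml2 by linarith
      \<comment> \<open>Weighting the two bounds by \<open>p2\<close> and \<open>M * l2\<close>
        makes the terms in \<open>norm (e k)\<close> cancel; this is the source of the harmonic-mean
        prefactor.\<close>
      have "(p2 + M * l2) * ?R \<le> M * l2 * p2 * (norm (e j))\<^sup>2"
        using mult_left_mono[OF R1 p2] mult_left_mono[OF R2 Ml2] by (simp add: algebra_simps)
      then show ?thesis using pos by (simp add: field_simps)
    qed
    \<comment> \<open>This bound refers to the error one cycle earlier, hence the exponent
      \<open>k - 1\<close>; the other one uses the decay up to \<open>k\<close>.\<close>
    also have "\<dots> \<le> ?C * (q ^ j * (norm (e 0))\<^sup>2)"
      using decay[of j] p2 Ml2 by (intro mult_left_mono) auto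
    finally have 1: "?R \<le> ?C * q ^ (k - 1) * (norm (e 0))\<^sup>2" by (simp add: k mult.assoc)
    have "?R \<le> p2 * (q ^ k * (norm (e 0))\<^sup>2)"
      using R2 mult_left_mono[OF decay[of k] p2] by linarith
    then have 2: "?R \<le> p2 * q ^ k * (norm (e 0))\<^sup>2" by (simp add: mult.assoc)
    from 1 2 show ?thesis by (simp add: min_def)
  qed
  have "p2 \<le> (singular_value A 1)\<^sup>2"
    unfolding p2_def
    by (intro power_mono op_norm_last_row_proj_singular_value nonzero_rows op_norm_nonneg)
  with op_norm_last_row_proj_frobenius[OF nonzero_rows]
  have p2_le: "p2 \<le> min (\<Sum>i\<in>UNIV. (norm (A $ i))\<^sup>2 * (1 - (B $ i \<bullet> B $ Max UNIV)\<^sup>2))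
      ((singular_value A 1)\<^sup>2)"
    by (simp add: p2_def B_def)
  have "l2 \<le> ((1 + real_of_int \<lceil>log 2 (real (rank A))\<rceil> / 2) * (singular_value B 1)\<^sup>2)\<^sup>2"
    unfolding l2_def B_def
    by (intro power_mono op_norm_lower_gram_rank nonzero_rows op_norm_nonneg)
  also have "\<dots> = (1 + real_of_int \<lceil>log 2 (real (rank A))\<rceil> / 2)\<^sup>2 * (singular_value B 1) ^ 4"
    by (simp add: power_mult_distrib flip: power_mult)
  finally have l2_le: "l2 \<le> min (\<Sum>(i, j)\<in>{(i, j). i < j}. (B $ i \<bullet> B $ j)\<^sup>2)
      ((1 + real_of_int \<lceil>log 2 (real (rank A))\<rceil> / 2)\<^sup>2 * (singular_value B 1) ^ 4)"
    using op_norm_lower_gram_frobenius[of A] by (simp add: l2_def B_def)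
  have e0: "e 0 = x\<^sub>0 - xs" by (simp add: e_def)
  show ?thesis
    unfolding Let_def B_def[symmetric] l2_def[symmetric] p2_def[symmetric] M_def[symmetric]
      xs_def[symmetric] \<sigma>_def[symmetric] q_def[symmetric] e_def[symmetric] residual
    using q bound p2_le l2_le unfolding e0 by blast
qed

end
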